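(* Let $f\in H^2((-1,1))$ with $\operatorname{supp} f\subset(-1,1)$, and for each wave number $\alpha>0$ let $u(\cdot,\alpha)\in H^2((-1,1))$ be the solution of $$u''(x,\alpha)+\alpha^2u(x,\alpha)=f(x),\quad x\in(-1,1),$$ $$u'(1,\alpha)+i\alpha u(1,\alpha)=0,\qquad u'(-1,\alpha)-i\alpha u(-1,\alpha)=0.$$ Then there exists a generic constant $C$ depending on the domain $(-1,1)$ such that $$\|f\|_{(0)}^2(-1,1)\le C\left(\epsilon^2+\frac{M^2}{1+K^{2/3}E^{1/4}}\right),$$ where $K>1$, $$\epsilon^2=\int_0^K\alpha^2\big(|u(1,\alpha)|^2+|u(-1,\alpha)|^2\big)\,d\alpha,$$ $E=-\ln\epsilon$, and $M=\max\{\|f\|_{(1)}^2(-1,1),\,1\}$.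
   Context: Primes denote derivatives in $x$. $\|\cdot\|_{(l)}(-1,1)$ denotes the standard Sobolev norm of $H^l((-1,1))$; in particular $\|\cdot\|_{(0)}(-1,1)$ is the $L^2(-1,1)$ norm. $\operatorname{supp} f\subset(-1,1)$ means that $f$ is compactly supported in the open interval $(-1,1)$. The number $\epsilon\ge 0$ is the nonnegative square root of the displayed integral. For $f\in L^2(-1,1)$ the boundary value problem has a unique solution $u(\cdot,\alpha)$ for each $\alpha>0$. *)

theory Defs
  imports "HOL-Analysis.Analysis"
begin

text \<open>Elements of \<open>L\<^sup>2\<close> and of the Sobolev spaces are represented by functions on the real line; only
  their values almost everywhere on the open set \<open>S\<close> matter.\<close>

definition square_integrable_on :: "(real \<Rightarrow> complex) \<Rightarrow> real set \<Rightarrow> bool" where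
  "square_integrable_on f S \<longleftrightarrow>
     f \<in> borel_measurable (lebesgue_on S) \<and> integrable (lebesgue_on S) (\<lambda>x. (cmod (f x))\<^sup>2)"

definition test_function :: "real set \<Rightarrow> (real \<Rightarrow> real) \<Rightarrow> bool" where
  "test_function S \<phi> \<longleftrightarrow>
     (\<forall>n x. (deriv ^^ n) \<phi> differentiable (at x)) \<and>
     (\<exists>A. compact A \<and> A \<subseteq> S \<and> (\<forall>x. x \<notin> A \<longrightarrow> \<phi> x = 0))"

definition is_weak_deriv ::
    "real set \<Rightarrow> nat \<Rightarrow> (real \<Rightarrow> complex) \<Rightarrow> (real \<Rightarrow> complex) \<Rightarrow> bool" where
  "is_weak_deriv S k f g \<longleftrightarrow>
     (\<forall>\<phi>. test_function S \<phi> \<longrightarrow>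
        (LINT x|lebesgue_on S. (deriv ^^ k) \<phi> x *\<^sub>R f x) =
        (- 1) ^ k * (LINT x|lebesgue_on S. \<phi> x *\<^sub>R g x))"

definition sobolev_space :: "nat \<Rightarrow> real set \<Rightarrow> (real \<Rightarrow> complex) set" where
  "sobolev_space l S =
     {f. square_integrable_on f S \<and>
         (\<forall>k\<le>l. \<exists>g. square_integrable_on g S \<and> is_weak_deriv S k f g)}"

text \<open>The choice below is unique up to equality almost everywhere on \<open>S\<close>.\<close>

definition weak_deriv :: "real set \<Rightarrow> nat \<Rightarrow> (real \<Rightarrow> complex) \<Rightarrow> real \<Rightarrow> complex" where
  "weak_deriv S k f = (SOME g. square_integrable_on g S \<and> is_weak_deriv S k f g)"

definition sobolev_norm :: "nat \<Rightarrow> real set \<Rightarrow> (real \<Rightarrow> complex) \<Rightarrow> real" where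
  "sobolev_norm l S f =
     sqrt (\<Sum>k\<le>l. LINT x|lebesgue_on S. (cmod (weak_deriv S k f x))\<^sup>2)"

definition compactly_supported_in :: "(real \<Rightarrow> complex) \<Rightarrow> real set \<Rightarrow> bool" where
  "compactly_supported_in f S \<longleftrightarrow>
     (\<exists>A. compact A \<and> A \<subseteq> S \<and> (AE x in lebesgue_on S. x \<notin> A \<longrightarrow> f x = 0))"

text \<open>The value at a point of the closure of \<open>S\<close> of the representative of \<open>v\<close> that is continuous up to
  the boundary. For an open interval it exists whenever \<open>v\<close> lies in \<open>H\<^sup>1\<close>.\<close>

definition trace_at :: "real set \<Rightarrow> (real \<Rightarrow> complex) \<Rightarrow> real \<Rightarrow> complex" where
  "trace_at S v x =
     (THE c. \<exists>w. continuous_on (closure S) w \<and> (AE t in lebesgue_on S. w t = v t) \<and> w x = c)"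

abbreviation domain_interval :: "real set" ("\<Omega>") where
  "\<Omega> \<equiv> {-1<..<1}"

definition helmholtz_solution :: "real \<Rightarrow> (real \<Rightarrow> complex) \<Rightarrow> (real \<Rightarrow> complex) \<Rightarrow> bool" where
  "helmholtz_solution \<alpha> f u \<longleftrightarrow>
     u \<in> sobolev_space 2 \<Omega> \<and>
     (AE x in lebesgue_on \<Omega>. weak_deriv \<Omega> 2 u x + (of_real \<alpha>)\<^sup>2 * u x = f x) \<and>
     trace_at \<Omega> (weak_deriv \<Omega> 1 u) 1 + \<i> * of_real \<alpha> * trace_at \<Omega> u 1 = 0 \<and>
     trace_at \<Omega> (weak_deriv \<Omega> 1 u) (-1) - \<i> * of_real \<alpha> * trace_at \<Omega> u (-1) = 0"

definition boundary_data :: "(real \<Rightarrow> real \<Rightarrow> complex) \<Rightarrow> real \<Rightarrow> real" where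
  "boundary_data u K =
     sqrt (LINT \<alpha>:{0..K}|lebesgue.
             \<alpha>\<^sup>2 * ((cmod (trace_at \<Omega> (u \<alpha>) 1))\<^sup>2 + (cmod (trace_at \<Omega> (u \<alpha>) (-1)))\<^sup>2))"

text \<open>\<open>- ln \<epsilon>\<close> for \<open>\<epsilon> \<ge> 0\<close>, with the value \<open>\<infinity>\<close> at \<open>\<epsilon> = 0\<close>, where HOL's \<open>ln\<close> would give \<open>0\<close>.\<close>

definition neg_ln :: "real \<Rightarrow> ereal" where
  "neg_ln \<epsilon> = (if \<epsilon> = 0 then \<infinity> else ereal (- ln \<epsilon>))"

text \<open>The fourth root on \<open>[0, \<infinity>]\<close>. It is extended by \<open>0\<close> to negative arguments, where the real power is
  undefined; such arguments \<open>E = - ln \<epsilon>\<close> occur only for \<open>\<epsilon> > 1\<close>.\<close>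

definition fourth_root :: "ereal \<Rightarrow> ereal" where
  "fourth_root x = (if x = \<infinity> then \<infinity> else ereal (max 0 (real_of_ereal x) powr (1/4)))"

end

theory Submission
  imports Defs
begin

text \<open>
  The solution enters only through the Fourier transform \<open>F \<alpha> = \<integral> f x e\<^bsup>i\<alpha>x\<^esup> dx\<close>: integrating the equation
  against \<open>e\<^bsup>\<plusminus>i\<alpha>x\<^esup>\<close> gives \<open>\<bar>F \<alpha>\<bar> = 2 \<alpha> \<bar>u(1, \<alpha>)\<bar>\<close> and \<open>\<bar>F (-\<alpha>)\<bar> = 2 \<alpha> \<bar>u(-1, \<alpha>)\<bar>\<close>, so \<open>4 \<epsilon>\<^sup>2\<close> is the
  energy of \<open>F\<close> on \<open>[-K, K]\<close>. Plancherel's theorem is replaced by the Fejer kernel: its positivity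
  yields, for every \<open>k > 0\<close>, \<open>\<parallel>f\<parallel>\<^sup>2 \<le> 2 \<integral>\<^bsub>[-k, k]\<^esub> \<bar>F\<bar>\<^sup>2 + 128 \<parallel>f\<parallel>\<^sub>1\<^sup>2 / k\<^sup>2\<close>, the norm on the right being
  that of \<open>H\<^sup>1\<close>. Put \<open>a = K\<^bsup>2/3\<^esup> E\<^bsup>1/4\<^esup>\<close>. If \<open>a \<le> K\<^sup>2\<close>, take \<open>k = K\<close>. Otherwise take \<open>k\<^sup>2 = a\<close>; then
  \<open>E \<ge> k\<^sup>4\<close>, and the smallness of \<open>F\<close> on \<open>[-1, 1]\<close> propagates to \<open>[-k, k]\<close>: expanding
  \<open>e\<^bsup>in\<eta>x\<^esup> = (1 + (e\<^bsup>i\<eta>x\<^esup> - 1))\<^sup>n\<close> by the binomial theorem writes \<open>F (n \<eta>)\<close> as a combination of finite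
  differences of \<open>F\<close> at \<open>0\<close>; the low orders only see \<open>F\<close> on \<open>[-1, 1]\<close>, and the high ones are bounded
  by \<open>\<bar>\<eta>\<bar>\<^sup>j\<close>.
\<close>


section \<open>Smooth bump functions\<close>

text \<open>The solution is known only through weak derivatives chosen by \<open>SOME\<close> and
  traces fixed by \<open>THE\<close>. Integration by parts needs genuine functions, so C^1
  representatives are first recovered from test functions alone. Compact support is what makes f,
  extended by zero, a C^1 function on the whole line, so that it can be compared with its translates
  in L^2. The exponents reflect a balance. Reaching frequency k takes about k^2 equal steps, so that
  the first O(k) of them stay inside [-1, 1]; this amplifies the data by exp(O(k^2)). Data of size
  exp(-k^4) absorb this at the price of one huge but absolute constant, while the truncation error,
  exponentially small in k, beats every power of k. Passing from the L^2 norm of F on [-1, 1] to its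
  supremum costs a square root: \<epsilon>^2 becomes \<epsilon>, which the quartic exponent also
  tolerates. Vanishing data have no finite logarithm. The estimate is therefore proved for every
  upper bound of the data in (0, 1), and that bound is sent to 0.\<close>

definition smooth :: "(real \<Rightarrow> real) \<Rightarrow> bool" where
  "smooth \<phi> \<longleftrightarrow> (\<forall>n x. (deriv ^^ n) \<phi> differentiable (at x))"

lemma smooth_iff_deriv:
  "smooth \<phi> \<longleftrightarrow> (\<forall>x. \<phi> differentiable (at x)) \<and> smooth (deriv \<phi>)"
proof
  assume *: "smooth \<phi>"
  have "(deriv ^^ n) (deriv \<phi>) differentiable (at x)" for n x
    using *[unfolded smooth_def, rule_format, of "Suc n" x] by (simp only: funpow_Suc_right o_apply)
  then show "(\<forall>x. \<phi> differentiable (at x)) \<and> smooth (deriv \<phi>)"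
    using *[unfolded smooth_def, rule_format, of 0] by (auto simp: smooth_def)
next
  assume *: "(\<forall>x. \<phi> differentiable (at x)) \<and> smooth (deriv \<phi>)"
  have "(deriv ^^ n) \<phi> differentiable (at x)" for n x
    using * by (cases n) (auto simp: smooth_def funpow_Suc_right simp del: funpow.simps(2))
  then show "smooth \<phi>"
    by (simp add: smooth_def)
qed

text \<open>Smooth functions form the largest class of differentiable functions closed under
  \<open>deriv\<close>, so membership in any such class suffices and no formula for an n-th
  derivative is ever needed.\<close>

lemma smooth_coinduct:
  assumes "P \<phi>"
    and step: "\<And>\<phi>. P \<phi> \<Longrightarrow> (\<forall>x. \<phi> differentiable (at x)) \<and> P (deriv \<phi>)"
  shows "smooth \<phi>"
proof -
  have "P ((deriv ^^ n) \<phi>)" for n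
    by (induction n) (use assms in auto)
  then show ?thesis
    using step by (auto simp: smooth_def)
qed

lemma smooth_has_deriv: "smooth \<phi> \<Longrightarrow> (\<phi> has_field_derivative deriv \<phi> x) (at x)"
  using smooth_iff_deriv DERIV_deriv_iff_real_differentiable by blast

lemma smooth_deriv: "smooth \<phi> \<Longrightarrow> smooth (deriv \<phi>)"
  using smooth_iff_deriv by blast

lemma smooth_continuous_on: "smooth \<phi> \<Longrightarrow> continuous_on S \<phi>"
  by (meson DERIV_isCont continuous_at_imp_continuous_on smooth_has_deriv)

lemma smooth_const: "smooth (\<lambda>_. c)"
  by (rule smooth_coinduct[of "\<lambda>f. \<exists>c. f = (\<lambda>_. c)"]) auto

text \<open>A product differentiates into a sum of products, so products alone are not closed under
  \<open>deriv\<close>. Closing under all operations at once gives a class to which coinduction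
  applies.\<close>

inductive smooth_closure :: "(real \<Rightarrow> real) \<Rightarrow> bool" where
  base: "smooth f \<Longrightarrow> smooth_closure f"
| add: "smooth_closure f \<Longrightarrow> smooth_closure g \<Longrightarrow> smooth_closure (\<lambda>x. f x + g x)"
| mult: "smooth_closure f \<Longrightarrow> smooth_closure g \<Longrightarrow> smooth_closure (\<lambda>x. f x * g x)"
| affine: "smooth_closure f \<Longrightarrow> smooth_closure (\<lambda>x. f (a * x + b))"

lemma smooth_closure_deriv:
  "smooth_closure f \<Longrightarrow> (\<forall>x. f differentiable (at x)) \<and> smooth_closure (deriv f)"
proof (induction rule: smooth_closure.induct)
  case (base f)
  then show ?case
    using smooth_iff_deriv smooth_closure.base by blast
next
  case (add f g)
  then have D: "((\<lambda>x. f x + g x) has_field_derivative deriv f x + deriv g x) (at x)" for x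
    by (intro DERIV_add) (auto simp: DERIV_deriv_iff_real_differentiable)
  then have "deriv (\<lambda>x. f x + g x) = (\<lambda>x. deriv f x + deriv g x)"
    by (auto intro: DERIV_imp_deriv)
  with add D show ?case
    by (auto intro: smooth_closure.add simp: real_differentiable_def)
next
  case (mult f g)
  then have D: "((\<lambda>x. f x * g x) has_field_derivative deriv f x * g x + deriv g x * f x) (at x)" for x
    by (intro DERIV_mult) (auto simp: DERIV_deriv_iff_real_differentiable)
  then have "deriv (\<lambda>x. f x * g x) = (\<lambda>x. deriv f x * g x + deriv g x * f x)"
    by (auto intro: DERIV_imp_deriv)
  with mult D show ?case
    by (auto intro!: smooth_closure.add smooth_closure.mult simp: real_differentiable_def)
next
  case (affine f a b)
  have D: "((\<lambda>x. f (a * x + b)) has_field_derivative a * deriv f (a * x + b)) (at x)" for x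
  proof -
    have "(f has_field_derivative deriv f (a * x + b)) (at (a * x + b))"
      using affine by (auto simp: DERIV_deriv_iff_real_differentiable)
    moreover have "((\<lambda>x. a * x + b) has_field_derivative a) (at x)"
      by (auto intro!: derivative_eq_intros)
    ultimately have "((\<lambda>x. f (a * x + b)) has_field_derivative deriv f (a * x + b) * a) (at x)"
      by (rule DERIV_chain2)
    then show ?thesis
      by (simp only: mult.commute)
  qed
  then have "deriv (\<lambda>x. f (a * x + b)) = (\<lambda>x. a * deriv f (a * x + b))"
    by (intro ext DERIV_imp_deriv)
  moreover have "smooth_closure (\<lambda>x. a * deriv f (a * x + b))"
    by (rule smooth_closure.mult[OF base[OF smooth_const] smooth_closure.affine]) (use affine in blast)
  ultimately show ?case
    using D by (auto simp: real_differentiable_def)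
qed

lemma smooth_closure_smooth: "smooth_closure f \<Longrightarrow> smooth f"
  by (rule smooth_coinduct[of smooth_closure]) (auto dest: smooth_closure_deriv)

text \<open>Multiplying \<open>e\<^bsup>-1/x\<^esup>\<close> by polynomials in \<open>1/x\<close> makes the family closed under differentiation.\<close>

definition flat_exp :: "real poly \<Rightarrow> real \<Rightarrow> real" where
  "flat_exp p x = (if x > 0 then poly p (1 / x) * exp (- (1 / x)) else 0)"

lemma poly_div_exp_tendsto_0:
  fixes p :: "real poly"
  shows "((\<lambda>t. poly p t / exp t) \<longlongrightarrow> 0) at_top"
proof -
  have "((\<lambda>t. \<Sum>i\<le>degree p. coeff p i * (t ^ i / exp t)) \<longlongrightarrow> (\<Sum>i\<le>degree p. coeff p i * 0)) at_top"
    by (intro tendsto_sum tendsto_mult tendsto_const tendsto_power_div_exp_0)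
  then show ?thesis
    by (simp add: poly_altdef sum_divide_distrib)
qed

text \<open>With t = 1/x the chain rule gives (p(t) e^(-t))' = t^2 (p(t) - p'(t)) e^(-t), whence the
  new polynomial. At 0 the right difference quotient is t p(t) e^(-t), which tends to 0 as t
  grows.\<close>

lemma flat_exp_has_deriv:
  "(flat_exp p has_field_derivative flat_exp (monom 1 2 * (p - pderiv p)) x) (at x)"
proof -
  consider "x > 0" | "x < 0" | "x = 0" by linarith
  then show ?thesis
  proof cases
    case 1
    have "((\<lambda>x. poly p (1 / x) * exp (- (1 / x))) has_field_derivative
            flat_exp (monom 1 2 * (p - pderiv p)) x) (at x)"
      using 1 by (auto intro!: derivative_eq_intros simp: flat_exp_def poly_monom field_simps power2_eq_square)
    then show ?thesis
      by (rule DERIV_cong_ev[THEN iffD1, rotated 3])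
        (use 1 eventually_nhds_in_open[of "{0<..}" x] in \<open>auto simp: flat_exp_def elim!: eventually_mono\<close>)
  next
    case 2
    have "((\<lambda>x. 0) has_field_derivative flat_exp (monom 1 2 * (p - pderiv p)) x) (at x)"
      using 2 by (auto simp: flat_exp_def)
    then show ?thesis
      by (rule DERIV_cong_ev[THEN iffD1, rotated 3])
        (use 2 eventually_nhds_in_open[of "{..<0}" x] in \<open>auto simp: flat_exp_def elim!: eventually_mono\<close>)
  next
    case 3
    have "((\<lambda>t. poly (monom 1 1 * p) t / exp t) \<longlongrightarrow> 0) at_top"
      by (rule poly_div_exp_tendsto_0)
    then have "((\<lambda>x. poly (monom 1 1 * p) (inverse x) / exp (inverse x)) \<longlongrightarrow> 0) (at_right 0)"
      by (rule filterlim_compose) (rule filterlim_inverse_at_top_right)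
    then have "((\<lambda>h. flat_exp p h / h) \<longlongrightarrow> 0) (at_right 0)"
      by (rule Lim_transform_eventually)
        (auto simp: eventually_at_right_field flat_exp_def poly_monom field_simps exp_minus
          intro!: exI[of _ 1])
    moreover have "((\<lambda>h. flat_exp p h / h) \<longlongrightarrow> 0) (at_left 0)"
      by (rule tendsto_eventually)
        (auto simp: eventually_at_left_field flat_exp_def intro!: exI[of _ "-1"])
    ultimately have "((\<lambda>h. flat_exp p h / h) \<longlongrightarrow> 0) (at 0)"
      by (simp add: filterlim_split_at)
    then show ?thesis
      using 3 by (simp add: DERIV_def flat_exp_def)
  qed
qed

lemma smooth_flat_exp: "smooth (flat_exp p)"
proof (rule smooth_coinduct[of "\<lambda>f. \<exists>p. f = flat_exp p"])
  fix \<phi> assume "\<exists>p. \<phi> = flat_exp p"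
  then obtain p where p: "\<phi> = flat_exp p" by blast
  then show "(\<forall>x. \<phi> differentiable (at x)) \<and> (\<exists>p. deriv \<phi> = flat_exp p)"
    using flat_exp_has_deriv DERIV_imp_deriv real_differentiable_def by (metis ext)
qed auto

text \<open>The parameter \<open>n\<close> steers the steepness of the flanks: the support stays in
  [a, b] while the values on (a, b) tend to 1 as \<open>n\<close> grows.\<close>

definition bump :: "real \<Rightarrow> real \<Rightarrow> real \<Rightarrow> real \<Rightarrow> real" where
  "bump n a b x = flat_exp 1 (n * (x - a)) * flat_exp 1 (n * (b - x))"

lemma smooth_bump: "smooth (bump n a b)"
proof -
  have "smooth_closure (\<lambda>x. flat_exp 1 (n * x + - n * a) * flat_exp 1 (-n * x + n * b))"
    by (rule smooth_closure.mult; rule smooth_closure.affine[OF smooth_closure.base[OF smooth_flat_exp]])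
  then show ?thesis
    by (simp add: bump_def[abs_def] algebra_simps smooth_closure_smooth)
qed

lemma flat_exp_1_bounds: "0 \<le> flat_exp 1 x" "flat_exp 1 x \<le> 1"
  by (auto simp: flat_exp_def)

lemma bump_bounds: "0 \<le> bump n a b x" "bump n a b x \<le> 1"
  by (auto simp: bump_def flat_exp_1_bounds mult_le_one)

lemma bump_pos: "n > 0 \<Longrightarrow> a < x \<Longrightarrow> x < b \<Longrightarrow> 0 < bump n a b x"
  by (auto simp: bump_def flat_exp_def)

lemma bump_eq_0: "n \<ge> 0 \<Longrightarrow> x \<le> a \<or> b \<le> x \<Longrightarrow> bump n a b x = 0"
  by (auto simp: bump_def flat_exp_def not_less mult_nonneg_nonpos mult_less_0_iff zero_less_mult_iff)

lemma bump_tendsto_indicator: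
  "(\<lambda>n. bump (real n) a b x) \<longlonglongrightarrow> indicator {a<..<b} x"
proof (cases "x \<in> {a<..<b}")
  case True
  have *: "(\<lambda>n. flat_exp 1 (real n * c)) \<longlonglongrightarrow> 1" if "c > 0" for c
  proof -
    have "(\<lambda>n. exp (- (inverse (real n) / c))) \<longlonglongrightarrow> exp (- (0 / c))"
      by (intro tendsto_intros LIMSEQ_inverse_real_of_nat lim_inverse_n) (use that in auto)
    moreover have "eventually (\<lambda>n. exp (- (inverse (real n) / c)) = flat_exp 1 (real n * c)) sequentially"
      using eventually_gt_at_top[of 0]
      by eventually_elim (use that in \<open>simp add: flat_exp_def field_simps\<close>)
    ultimately show ?thesis
      using Lim_transform_eventually by fastforce
  qed
  show ?thesis
    using tendsto_mult[OF *[of "x - a"] *[of "b - x"]] True by (simp add: bump_def)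
next
  case False
  then show ?thesis
    using bump_eq_0[of _ x a b] by auto
qed

lemma test_function_iff:
  "test_function S \<phi> \<longleftrightarrow> smooth \<phi> \<and> (\<exists>A. compact A \<and> A \<subseteq> S \<and> (\<forall>x. x \<notin> A \<longrightarrow> \<phi> x = 0))"
  by (simp add: test_function_def smooth_def)

lemma test_function_bump:
  assumes "n \<ge> 0" "{a..b} \<subseteq> S"
  shows "test_function S (bump n a b)"
proof -
  have "x \<notin> {a..b} \<longrightarrow> bump n a b x = 0" for x
    using assms bump_eq_0[of n x a b] by (cases "x \<le> a") auto
  then show ?thesis
    using assms smooth_bump by (auto simp: test_function_iff intro!: exI[of _ "{a..b}"])
qed

section \<open>Weak derivatives\<close>

abbreviation \<Lambda> :: "real measure" where
  "\<Lambda> \<equiv> lebesgue_on \<Omega>"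

lemma integrable_Omega_bounded_mult:
  fixes v :: "real \<Rightarrow> complex" and \<phi> :: "real \<Rightarrow> real"
  assumes "integrable \<Lambda> v" "continuous_on UNIV \<phi>" "\<And>x. x \<in> \<Omega> \<Longrightarrow> \<bar>\<phi> x\<bar> \<le> B"
  shows "integrable \<Lambda> (\<lambda>x. \<phi> x *\<^sub>R v x)"
proof (rule Bochner_Integration.integrable_bound)
  show "integrable \<Lambda> (\<lambda>x. B *\<^sub>R v x)"
    using assms by auto
  have "\<phi> \<in> borel_measurable \<Lambda>"
    using assms(2) by (intro measurable_restrict_space1 measurable_completion) (auto intro: borel_measurable_continuous_onI)
  then show "(\<lambda>x. \<phi> x *\<^sub>R v x) \<in> borel_measurable \<Lambda>"
    using assms(1) by measurable
  have "norm (\<phi> x *\<^sub>R v x) \<le> norm (B *\<^sub>R v x)" if "x \<in> \<Omega>" for x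
    using assms(3)[OF that] by (auto intro!: mult_right_mono)
  then show "AE x in \<Lambda>. norm (\<phi> x *\<^sub>R v x) \<le> norm (B *\<^sub>R v x)"
    by (auto intro!: AE_I2)
qed

lemma continuous_bounded_Omega:
  fixes \<phi> :: "real \<Rightarrow> real"
  assumes "continuous_on UNIV \<phi>"
  obtains B where "\<And>x. x \<in> \<Omega> \<Longrightarrow> \<bar>\<phi> x\<bar> \<le> B"
proof -
  have "compact (\<phi> ` {-1..1})"
    using assms by (intro compact_continuous_image) (auto intro: continuous_on_subset)
  then obtain B where "\<forall>y\<in>\<phi> ` {-1..1}. norm y \<le> B"
    using compact_imp_bounded bounded_iff by blast
  then show ?thesis
    by (intro that[of B]) auto
qed

lemma integrable_Omega_mult:
  fixes v :: "real \<Rightarrow> complex" and \<phi> :: "real \<Rightarrow> real"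
  assumes "integrable \<Lambda> v" "continuous_on UNIV \<phi>"
  shows "integrable \<Lambda> (\<lambda>x. \<phi> x *\<^sub>R v x)"
  using continuous_bounded_Omega[OF assms(2)] integrable_Omega_bounded_mult[OF assms] by metis

lemma integral_Omega_eq:
  fixes v :: "real \<Rightarrow> 'a::euclidean_space"
  assumes "integrable \<Lambda> v"
  shows "(LINT x|\<Lambda>. v x) = integral {-1..1} v" "v integrable_on {-1..1}"
proof -
  show "(LINT x|\<Lambda>. v x) = integral {-1..1} v"
    using lebesgue_integral_eq_integral[OF assms] by (simp add: integral_open_interval_real)
  show "v integrable_on {-1..1}"
    using integrable_on_lebesgue_on[OF assms] by (simp add: integrable_on_Icc_iff_Ioo)
qed

lemma integrable_Omega_continuous:
  fixes v :: "real \<Rightarrow> 'a::euclidean_space"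
  assumes "continuous_on {-1..1} v"
  shows "integrable \<Lambda> v"
proof -
  have "set_integrable lborel {-1..1} v"
    using assms by (rule borel_integrable_atLeastAtMost')
  then have "set_integrable lborel \<Omega> v"
    by (rule set_integrable_subset) auto
  then show ?thesis
    by (simp add: integrable_restrict_space set_integrable_def integrable_completion)
qed

lemma AE_Omega_iff: "(AE x in \<Lambda>. P x) \<longleftrightarrow> (AE x in lebesgue. x \<in> \<Omega> \<longrightarrow> P x)"
  by (rule AE_restrict_space_iff) auto

text \<open>Bumps converge boundedly to the indicator of an interval, so v has integral 0 over every
  compact subinterval. By Lebesgue differentiation v is almost everywhere a limit of such
  means.\<close>

lemma fundamental_lemma:
  fixes v :: "real \<Rightarrow> complex"
  assumes v: "integrable \<Lambda> v"
    and 0: "\<And>\<phi>. test_function \<Omega> \<phi> \<Longrightarrow> (LINT x|\<Lambda>. \<phi> x *\<^sub>R v x) = 0"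
  shows "AE x in \<Lambda>. v x = 0"
proof -
  have int0: "integral {a..b} v = 0" if ab: "{a..b} \<subseteq> \<Omega>" for a b
  proof -
    have "(\<lambda>n. LINT x|\<Lambda>. bump (real n) a b x *\<^sub>R v x)
            \<longlonglongrightarrow> (LINT x|\<Lambda>. indicator {a<..<b} x *\<^sub>R v x)"
    proof (rule integral_dominated_convergence[where w = "\<lambda>x. norm (v x)"])
      show "AE x in \<Lambda>. (\<lambda>n. bump (real n) a b x *\<^sub>R v x) \<longlonglongrightarrow> indicator {a<..<b} x *\<^sub>R v x"
        by (intro AE_I2 tendsto_intros bump_tendsto_indicator)
      show "AE x in \<Lambda>. norm (bump (real n) a b x *\<^sub>R v x) \<le> norm (v x)" for n
        using bump_bounds[of "real n" a b] by (intro AE_I2) (auto intro!: mult_left_le_one_le)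
      show "(\<lambda>x. indicator {a<..<b} x *\<^sub>R v x) \<in> borel_measurable \<Lambda>"
      proof -
        have "(indicator {a<..<b} :: real \<Rightarrow> real) \<in> borel_measurable \<Lambda>"
          by (intro measurable_restrict_space1 measurable_completion) auto
        then show ?thesis
          using v by measurable
      qed
      show "(\<lambda>x. bump (real n) a b x *\<^sub>R v x) \<in> borel_measurable \<Lambda>" for n
        using integrable_Omega_mult[OF v smooth_continuous_on[OF smooth_bump[of "real n" a b]]]
        by auto
    qed (use v in auto)
    moreover have "(LINT x|\<Lambda>. bump (real n) a b x *\<^sub>R v x) = 0" for n
      by (intro 0 test_function_bump ab) auto
    ultimately have "(LINT x|\<Lambda>. indicator {a<..<b} x *\<^sub>R v x) = 0"
      using LIMSEQ_unique[of "\<lambda>n. 0"] by auto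
    moreover have "integrable \<Lambda> (\<lambda>x. indicator {a<..<b} x *\<^sub>R v x)"
    proof (rule integrable_mult_indicator[OF _ v])
      show "{a<..<b} \<in> sets \<Lambda>"
        using ab by (intro sets_restrict_space_iff[THEN iffD2]) (auto intro: order.strict_trans2 simp: subset_iff)
    qed
    ultimately have "integral \<Omega> (\<lambda>x. indicator {a<..<b} x *\<^sub>R v x) = 0"
      by (subst (asm) lebesgue_integral_eq_integral) auto
    moreover have "(\<lambda>x. indicator {a<..<b} x *\<^sub>R v x) = (\<lambda>x. if x \<in> {a<..<b} then v x else 0)"
      by (auto simp: indicator_def)
    moreover have "{a<..<b} \<inter> \<Omega> = {a<..<b}"
      using ab by (force simp: subset_iff)
    ultimately show ?thesis
      by (simp only: Henstock_Kurzweil_Integration.integral_restrict_Int integral_open_interval_real)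
  qed
  \<comment> \<open>The differentiation theorem is applied to a function integrable over every box
    of the line, hence the extension by zero.\<close>
  define w where "w x = (if x \<in> \<Omega> then v x else 0)" for x
  have w: "w integrable_on UNIV"
    using integrable_on_lebesgue_on[OF v] unfolding w_def
    by (subst integrable_restrict_UNIV) auto
  have "w integrable_on cbox a b" for a b
    using integrable_on_subcbox[OF w] by auto
  then obtain N where N: "negligible N"
    "\<And>x e. x \<notin> N \<Longrightarrow> 0 < e \<Longrightarrow> \<exists>d>0. \<forall>h. 0 < h \<and> h < d \<longrightarrow>
        norm (integral (cbox x (x + h *\<^sub>R One)) w /\<^sub>R h ^ DIM(real) - w x) < e"
    using integrable_ccontinuous_explicit[of w] by blast
  have "w x = 0" if x: "x \<notin> N" "x \<in> \<Omega>" for x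
  proof (rule ccontr)
    assume "w x \<noteq> 0"
    then obtain d where d: "d > 0" "\<And>h. 0 < h \<Longrightarrow> h < d \<Longrightarrow>
        norm (integral {x..x + h} w /\<^sub>R h - w x) < norm (w x)"
      using N(2)[OF x(1), of "norm (w x)"] by auto
    define h where "h = min (d / 2) ((1 - x) / 2)"
    have h: "0 < h" "h < d" "x + h < 1"
      using d x by (auto simp: h_def min_def field_simps)
    have "integral {x..x + h} w = integral {x..x + h} v"
      using h x by (intro integral_cong) (auto simp: w_def)
    also have "\<dots> = 0"
      using h x by (intro int0) auto
    finally show False
      using d(2)[OF h(1,2)] by simp
  qed
  then have "{x. \<not> (x \<in> \<Omega> \<longrightarrow> v x = 0)} \<subseteq> N"
    by (auto simp: w_def)
  then show ?thesis
    unfolding AE_Omega_iff using N(1)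
    by (intro AE_I'[of N]) (auto simp: negligible_iff_null_sets)
qed

lemma test_function_Omega_iff:
  "test_function \<Omega> \<phi> \<longleftrightarrow> smooth \<phi> \<and> (\<exists>r. 0 \<le> r \<and> r < 1 \<and> (\<forall>x. r \<le> \<bar>x\<bar> \<longrightarrow> \<phi> x = 0))"
proof
  assume "test_function \<Omega> \<phi>"
  then obtain A where A: "smooth \<phi>" "compact A" "A \<subseteq> \<Omega>" "\<And>x. x \<notin> A \<Longrightarrow> \<phi> x = 0"
    by (auto simp: test_function_iff)
  show "smooth \<phi> \<and> (\<exists>r. 0 \<le> r \<and> r < 1 \<and> (\<forall>x. r \<le> \<bar>x\<bar> \<longrightarrow> \<phi> x = 0))"
  proof (cases "A = {}")
    case False
    then obtain y where y: "y \<in> A" "\<And>x. x \<in> A \<Longrightarrow> \<bar>x\<bar> \<le> \<bar>y\<bar>"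
      using continuous_attains_sup[of A abs] A(2) continuous_on_rabs[OF continuous_on_id] by blast
    have "y \<in> \<Omega>"
      using y(1) A(3) by blast
    then have "\<bar>y\<bar> < 1"
      by (simp add: abs_less_iff)
    \<comment> \<open>The midpoint between \<bar>y\<bar> and 1 lies strictly beyond A, so even the
      closed condition r \<le> \<bar>x\<bar> keeps x out of A.\<close>
    then show ?thesis
      using A(1,4) y by (intro conjI exI[of _ "(\<bar>y\<bar> + 1) / 2"]) force+
  qed (use A in \<open>auto intro!: exI[of _ 0]\<close>)
next
  assume *: "smooth \<phi> \<and> (\<exists>r. 0 \<le> r \<and> r < 1 \<and> (\<forall>x. r \<le> \<bar>x\<bar> \<longrightarrow> \<phi> x = 0))"
  then obtain r where r: "0 \<le> r" "r < 1" "\<And>x. r \<le> \<bar>x\<bar> \<Longrightarrow> \<phi> x = 0"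
    by auto
  have "\<phi> x = 0" if "x \<notin> {-r..r}" for x
    using that r(1) by (intro r(3)) auto
  then show "test_function \<Omega> \<phi>"
    using * r by (auto simp: test_function_iff intro!: exI[of _ "{-r..r}"])
qed

text \<open>The primitive starting at -1 is constant to the right of the support, and the zero mean
  makes this constant 0.\<close>

lemma test_function_primitive:
  assumes \<psi>: "test_function \<Omega> \<psi>" and 0: "integral {-1..1} \<psi> = 0"
  obtains \<phi> where "test_function \<Omega> \<phi>" "deriv \<phi> = \<psi>"
proof -
  obtain r where r: "0 \<le> r" "r < 1" "\<And>x. r \<le> \<bar>x\<bar> \<Longrightarrow> \<psi> x = 0" and sm: "smooth \<psi>"
    using \<psi> by (auto simp: test_function_Omega_iff)
  note cont = smooth_continuous_on[OF sm]
  define \<phi> where "\<phi> x = integral {-1..x} \<psi>" for x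
  have left: "\<phi> x = 0" if "x \<le> -r" for x
  proof -
    have "\<phi> x = integral {-1..x} (\<lambda>_. 0)"
      unfolding \<phi>_def using that r by (intro integral_cong) auto
    then show ?thesis by simp
  qed
  have right: "\<phi> x = 0" if "r \<le> x" for x
  proof -
    have *: "\<phi> y = \<phi> r" if "y \<ge> r" for y
    proof -
      have "integral {r..y} \<psi> = integral {r..y} (\<lambda>_. 0)"
        using that r by (intro integral_cong) auto
      then show ?thesis
        using that r Henstock_Kurzweil_Integration.integral_combine[of "-1" r y \<psi>]
          integrable_continuous_real[OF cont, of "-1" y]
        by (simp add: \<phi>_def)
    qed
    show ?thesis
      using *[of x] *[of 1] 0 that r by (simp add: \<phi>_def)
  qed
  have D: "(\<phi> has_field_derivative \<psi> x) (at x)" for x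
  proof (cases "x < -r")
    case True
    have "((\<lambda>_. 0) has_field_derivative \<psi> x) (at x)"
      using r True by auto
    then show ?thesis
      by (rule DERIV_cong_ev[THEN iffD1, rotated 3])
        (use True eventually_nhds_in_open[of "{..<-r}" x] left in \<open>auto elim!: eventually_mono\<close>)
  next
    case False
    then have "(\<phi> has_field_derivative \<psi> x) (at x within {-1..x+1})"
      unfolding \<phi>_def using r by (intro integral_has_real_derivative cont) auto
    then show ?thesis
      using False r by (subst (asm) at_within_interior) (auto simp: interior_atLeastAtMost_real)
  qed
  then have "deriv \<phi> = \<psi>"
    by (intro ext DERIV_imp_deriv)
  moreover have "smooth \<phi>"
    using D sm \<open>deriv \<phi> = \<psi>\<close> by (subst smooth_iff_deriv) (auto simp: real_differentiable_def)
  then have "test_function \<Omega> \<phi>"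
    unfolding test_function_Omega_iff using r left right
    by (intro conjI exI[of _ r]) (auto simp: abs_if split: if_splits)
  ultimately show ?thesis
    using that by blast
qed

text \<open>Subtracting from a test function the multiple of a fixed bump \<rho> with the same
  integral leaves the derivative of a test function, on which v vanishes. So v acts on every test
  function like the constant c, its \<rho>-weighted mean.\<close>

lemma du_Bois_Reymond:
  fixes v :: "real \<Rightarrow> complex"
  assumes v: "integrable \<Lambda> v"
    and 0: "\<And>\<phi>. test_function \<Omega> \<phi> \<Longrightarrow> (LINT x|\<Lambda>. deriv \<phi> x *\<^sub>R v x) = 0"
  shows "\<exists>c. AE x in \<Lambda>. v x = c"
proof -
  define \<rho> where "\<rho> = bump 1 (-1/2) (1/2)"
  have \<rho>: "test_function \<Omega> \<rho>" "smooth \<rho>"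
    unfolding \<rho>_def by (auto intro!: test_function_bump smooth_bump)
  define I where "I = integral {-1..1} \<rho>"
  have "I \<noteq> 0"
  proof
    assume "I = 0"
    then have "\<forall>x\<in>{-1..1}. \<rho> x = 0"
      unfolding I_def using integral_eq_0_iff[of "-1" 1 \<rho>] smooth_continuous_on[OF \<rho>(2)]
      by (auto simp: \<rho>_def bump_bounds)
    then show False
      using bump_pos[of 1 "-1/2" 0 "1/2"] by (force simp: \<rho>_def)
  qed
  define c where "c = (LINT x|\<Lambda>. \<rho> x *\<^sub>R v x) /\<^sub>R I"
  have "AE x in \<Lambda>. v x - c = 0"
  proof (rule fundamental_lemma)
    have "integrable \<Lambda> (\<lambda>_. c)"
      by (rule integrable_Omega_continuous) auto
    then show "integrable \<Lambda> (\<lambda>x. v x - c)"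
      using v by auto
    fix \<psi> assume \<psi>: "test_function \<Omega> \<psi>"
    then have sm: "smooth \<psi>" by (auto simp: test_function_Omega_iff)
    define J where "J = integral {-1..1} \<psi>"
    define \<eta> where "\<eta> x = \<psi> x + (- J / I) * \<rho> x" for x
    have int: "f integrable_on {-1..1}" if "smooth f" for f :: "real \<Rightarrow> real"
      by (intro integrable_continuous_real smooth_continuous_on that)
    have "smooth_closure \<eta>"
      unfolding \<eta>_def[abs_def]
      by (intro smooth_closure.add smooth_closure.mult smooth_closure.base sm \<rho> smooth_const)
    then have "smooth \<eta>" by (rule smooth_closure_smooth)
    moreover have "\<exists>r. 0 \<le> r \<and> r < 1 \<and> (\<forall>x. r \<le> \<bar>x\<bar> \<longrightarrow> \<eta> x = 0)"
    proof -
      obtain r s where "0 \<le> r" "r < 1" "\<forall>x. r \<le> \<bar>x\<bar> \<longrightarrow> \<psi> x = 0"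
        and "0 \<le> s" "s < 1" "\<forall>x. s \<le> \<bar>x\<bar> \<longrightarrow> \<rho> x = 0"
        using \<psi> \<rho>(1) unfolding test_function_Omega_iff by blast
      then show ?thesis
        by (intro exI[of _ "max r s"]) (auto simp: \<eta>_def)
    qed
    ultimately have \<eta>: "test_function \<Omega> \<eta>"
      by (simp add: test_function_Omega_iff)
    have "integral {-1..1} \<eta> = J + (- J / I) * I"
      unfolding \<eta>_def[abs_def] J_def I_def
      by (subst integral_add[OF int[OF sm] integrable_on_mult_right[OF int[OF \<rho>(2)]]]) simp
    then obtain \<phi> where "test_function \<Omega> \<phi>" "deriv \<phi> = \<eta>"
      using test_function_primitive[OF \<eta>] \<open>I \<noteq> 0\<close> by auto
    then have "(LINT x|\<Lambda>. \<eta> x *\<^sub>R v x) = 0"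
      using 0 by blast
    moreover have iv: "integrable \<Lambda> (\<lambda>x. \<psi> x *\<^sub>R v x)" "integrable \<Lambda> (\<lambda>x. \<rho> x *\<^sub>R v x)"
      using v by (auto intro!: integrable_Omega_mult smooth_continuous_on sm \<rho>)
    have "(LINT x|\<Lambda>. \<eta> x *\<^sub>R v x) =
        (LINT x|\<Lambda>. \<psi> x *\<^sub>R v x) + (- J / I) *\<^sub>R (LINT x|\<Lambda>. \<rho> x *\<^sub>R v x)"
    proof -
      have "(LINT x|\<Lambda>. \<eta> x *\<^sub>R v x) = (LINT x|\<Lambda>. \<psi> x *\<^sub>R v x + (- J / I) *\<^sub>R (\<rho> x *\<^sub>R v x))"
        by (simp add: \<eta>_def scaleR_diff_left)
      then show ?thesis
        using iv by (simp only: Bochner_Integration.integral_add integrable_scaleR_right integral_scaleR_right)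
    qed
    moreover have "(LINT x|\<Lambda>. \<psi> x *\<^sub>R c) = J *\<^sub>R c" "integrable \<Lambda> (\<lambda>x. \<psi> x *\<^sub>R c)"
    proof -
      have i\<psi>: "integrable \<Lambda> \<psi>"
        by (intro integrable_Omega_continuous smooth_continuous_on sm)
      then show "integrable \<Lambda> (\<lambda>x. \<psi> x *\<^sub>R c)" by auto
      show "(LINT x|\<Lambda>. \<psi> x *\<^sub>R c) = J *\<^sub>R c"
        using i\<psi> by (simp add: J_def integral_Omega_eq)
    qed
    ultimately show "(LINT x|\<Lambda>. \<psi> x *\<^sub>R (v x - c)) = 0"
      using iv \<open>I \<noteq> 0\<close> by (simp add: scaleR_diff_right c_def field_simps)
  qed
  then show ?thesis
    by (intro exI[of _ c]) auto
qed

text \<open>Fubini on the plane is used for the product of Borel-Lebesgue measures, so a merely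
  Lebesgue measurable function has to be replaced by a Borel one first.\<close>

lemma borel_representative:
  fixes g :: "real \<Rightarrow> complex"
  assumes "g \<in> borel_measurable \<Lambda>"
  obtains g0 where "g0 \<in> borel_measurable borel" "AE x in \<Lambda>. g x = g0 x" "\<And>x. x \<notin> \<Omega> \<Longrightarrow> g0 x = 0"
proof -
  define h where "h x = indicator \<Omega> x *\<^sub>R g x" for x
  have "h \<in> borel_measurable lebesgue"
    using assms unfolding h_def by (subst (asm) borel_measurable_restrict_space_iff) auto
  then have "(\<lambda>x. Re (h x)) \<in> borel_measurable lebesgue" "(\<lambda>x. Im (h x)) \<in> borel_measurable lebesgue"
    by (auto simp: borel_measurable_complex_iff)
  then obtain r i where ri: "r \<in> borel_measurable lborel" "AE x in lborel. Re (h x) = r x"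
    "i \<in> borel_measurable lborel" "AE x in lborel. Im (h x) = i x"
    using completion_ex_borel_measurable_real by metis
  define g0 where "g0 x = indicator \<Omega> x *\<^sub>R Complex (r x) (i x)" for x
  show ?thesis
  proof (rule that[of g0])
    have [measurable]: "r \<in> borel_measurable borel" "i \<in> borel_measurable borel"
      using ri by simp_all
    have "(\<lambda>x. Complex (r x) (i x)) \<in> borel_measurable borel"
      by (subst borel_measurable_complex_iff) simp
    then show "g0 \<in> borel_measurable borel"
      unfolding g0_def by (intro borel_measurable_scaleR) auto
    have "AE x in lborel. x \<in> \<Omega> \<longrightarrow> g x = g0 x"
      using ri(2,4) by eventually_elim (auto simp: g0_def h_def complex_eq_iff)
    then show "AE x in \<Lambda>. g x = g0 x"
      unfolding AE_Omega_iff by (rule AE_completion)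
  qed (auto simp: g0_def)
qed

text \<open>Fubini on the triangle t < x: exchanging the order leaves g(t) times the integral of
  \<phi>' over (t, 1], which is -\<phi>(t) because \<phi>(1) = 0. Thus g need only be
  integrable.\<close>

lemma integral_by_parts_primitive:
  fixes g :: "real \<Rightarrow> complex" and \<phi> :: "real \<Rightarrow> real"
  assumes g: "integrable \<Lambda> g"
    and D: "\<And>x. (\<phi> has_field_derivative \<phi>' x) (at x)"
    and cont: "continuous_on UNIV \<phi>'" and \<phi>1: "\<phi> 1 = 0"
  shows "(LINT x|\<Lambda>. \<phi>' x *\<^sub>R integral {-1..x} g) = - (LINT x|\<Lambda>. \<phi> x *\<^sub>R g x)"
proof -
  obtain g0 where g0[measurable]: "g0 \<in> borel_measurable borel" and ae: "AE x in \<Lambda>. g x = g0 x"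
    and g0_out: "\<And>x. x \<notin> \<Omega> \<Longrightarrow> g0 x = 0"
    using borel_representative[of g] g by (metis borel_measurable_integrable)
  have ig0\<Lambda>: "integrable \<Lambda> g0"
    using g ae g0 by (subst integrable_cong_AE[of _ _ g]) (auto intro!: measurable_restrict_space1 measurable_completion)
  have g0_ind: "(\<lambda>x. indicator \<Omega> x *\<^sub>R g0 x) = g0"
    using g0_out by (auto simp: indicator_def fun_eq_iff)
  have ig0: "integrable lborel g0"
    using ig0\<Lambda> g0 by (simp add: integrable_restrict_space g0_ind integrable_completion)
  have cont\<phi>: "continuous_on UNIV \<phi>"
    using D by (meson DERIV_isCont continuous_at_imp_continuous_on)
  have [measurable]: "\<phi> \<in> borel_measurable borel" "\<phi>' \<in> borel_measurable borel"
    using cont cont\<phi> by (auto intro: borel_measurable_continuous_onI)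
  define k where "k x = indicator {-1..1} x * \<phi>' x" for x
  have [measurable]: "k \<in> borel_measurable borel"
    unfolding k_def by measurable
  have ik: "integrable lborel k"
    using borel_integrable_atLeastAtMost'[of "-1" 1 \<phi>'] cont continuous_on_subset
    by (force simp: set_integrable_def k_def[abs_def])
  define H where "H x t = (if t < x then k x *\<^sub>R g0 t else 0)" for x t
  have Hm: "case_prod H \<in> borel_measurable (lborel \<Otimes>\<^sub>M lborel)"
    unfolding H_def[abs_def] by measurable
  have "integrable (lborel \<Otimes>\<^sub>M lborel) (case_prod H)"
  proof (rule lborel_pair.Fubini_integrable[OF Hm])
    have [measurable]: "(\<lambda>x. \<integral>t. norm (H x t) \<partial>lborel) \<in> borel_measurable lborel"
      unfolding H_def[abs_def] by measurable
    show iH: "AE x in lborel. integrable lborel (\<lambda>y. case (x, y) of (x, xa) \<Rightarrow> H x xa)"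
    proof (intro AE_I2)
      fix x
      have "integrable lborel (\<lambda>t. k x *\<^sub>R g0 t)" using ig0 by auto
      then show "integrable lborel (\<lambda>y. case (x, y) of (x, xa) \<Rightarrow> H x xa)"
        by (rule Bochner_Integration.integrable_bound) (auto simp: H_def)
    qed
    show "integrable lborel (\<lambda>x. \<integral>y. norm (case (x, y) of (x, xa) \<Rightarrow> H x xa) \<partial>lborel)"
    proof (rule Bochner_Integration.integrable_bound[where f = "\<lambda>x. k x * (\<integral>y. norm (g0 y) \<partial>lborel)"])
      show "integrable lborel (\<lambda>x. k x * (\<integral>y. norm (g0 y) \<partial>lborel))"
        using ik by auto
      have "(\<integral>y. norm (H x y) \<partial>lborel) \<le> \<bar>k x\<bar> * (\<integral>y. norm (g0 y) \<partial>lborel)" for x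
      proof -
        have "(\<integral>y. norm (H x y) \<partial>lborel) \<le> (\<integral>y. \<bar>k x\<bar> * norm (g0 y) \<partial>lborel)"
          by (rule integral_mono') (use ig0 in \<open>auto simp: H_def\<close>)
        then show ?thesis by simp
      qed
      then show "AE x in lborel. norm (\<integral>y. norm (case (x, y) of (x, xa) \<Rightarrow> H x xa) \<partial>lborel)
          \<le> norm (k x * (\<integral>y. norm (g0 y) \<partial>lborel))"
        by (auto simp: abs_mult)
    qed auto
  qed
  then have swap: "(\<integral>t. (\<integral>x. H x t \<partial>lborel) \<partial>lborel) = (\<integral>x. (\<integral>t. H x t \<partial>lborel) \<partial>lborel)"
    by (rule lborel_pair.Fubini_integral)
  have intg: "integral {-1..x} g = integral {-1..x} g0" if "x \<le> 1" for x
  proof -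
    have "AE t in lebesgue. t \<in> \<Omega> \<longrightarrow> g t = g0 t"
      using ae by (simp add: AE_Omega_iff)
    then obtain N where N: "N \<in> null_sets lebesgue" "{t. \<not> (t \<in> \<Omega> \<longrightarrow> g t = g0 t)} \<subseteq> N"
      by (auto simp: eventually_ae_filter)
    show ?thesis
      by (rule integral_spike[of "insert (-1) (insert 1 N)"])
        (use that N in \<open>force simp: negligible_iff_null_sets[symmetric] subset_iff\<close>)+
  qed
  have inner: "(\<integral>t. H x t \<partial>lborel) = k x *\<^sub>R integral {-1..x} g" for x
  proof (cases "x \<in> {-1..1}")
    case True
    have eq: "(\<lambda>t. H x t) = (\<lambda>t. k x *\<^sub>R (indicator {-1<..<x} t *\<^sub>R g0 t))"
      using True g0_out by (auto simp: H_def indicator_def fun_eq_iff)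
    have "set_integrable lborel {-1<..<x} g0"
      using ig0 by (simp add: set_integrable_def integrable_mult_indicator)
    then have "(\<integral>t. indicator {-1<..<x} t *\<^sub>R g0 t \<partial>lborel) = integral {-1<..<x} g0"
      using set_borel_integral_eq_integral(2) by (fastforce simp: set_lebesgue_integral_def)
    moreover have "(\<integral>t. H x t \<partial>lborel) = k x *\<^sub>R (\<integral>t. indicator {-1<..<x} t *\<^sub>R g0 t \<partial>lborel)"
      unfolding eq by (rule integral_scaleR_right)
    ultimately show ?thesis
      using intg[of x] True by (simp add: integral_open_interval_real)
  next
    case False
    then have "k x = 0"
      by (simp add: k_def)
    then show ?thesis
      by (simp add: H_def if_distrib cong: if_cong)
  qed
  have outer: "(\<integral>x. H x t \<partial>lborel) = - (\<phi> t *\<^sub>R g0 t)" for t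
  proof (cases "t \<in> \<Omega>")
    case True
    have eq: "(\<lambda>x. H x t) = (\<lambda>x. (indicator {t<..1} x *\<^sub>R \<phi>' x) *\<^sub>R g0 t)"
      using True by (auto simp: H_def k_def indicator_def fun_eq_iff)
    have "(\<phi>' has_integral (\<phi> 1 - \<phi> t)) {t..1}"
      using True D by (intro fundamental_theorem_of_calculus)
        (auto simp flip: has_real_derivative_iff_has_vector_derivative intro: has_field_derivative_at_within)
    moreover have "{x \<in> {t..1} - {t<..1}. \<phi>' x \<noteq> 0} \<subseteq> {t}" "{x \<in> {t<..1} - {t..1}. \<phi>' x \<noteq> 0} \<subseteq> {t}"
      by auto
    then have "negligible {x \<in> {t..1} - {t<..1}. \<phi>' x \<noteq> 0}" "negligible {x \<in> {t<..1} - {t..1}. \<phi>' x \<noteq> 0}"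
      using negligible_subset[OF negligible_sing] by blast+
    ultimately have "(\<phi>' has_integral (\<phi> 1 - \<phi> t)) {t<..1}"
      by (subst (asm) has_integral_spike_set_eq[of "{t..1}" "{t<..1}"])
    then have "integral {t<..1} \<phi>' = - \<phi> t"
      using \<phi>1 by (simp add: integral_unique)
    moreover have "set_integrable lborel {t<..1} \<phi>'"
      using borel_integrable_atLeastAtMost'[of t 1 \<phi>'] cont continuous_on_subset
      by (rule_tac set_integrable_subset[of _ "{t..1}"]) auto
    ultimately have "(\<integral>x. indicator {t<..1} x *\<^sub>R \<phi>' x \<partial>lborel) = - \<phi> t"
      "integrable lborel (\<lambda>x. indicator {t<..1} x *\<^sub>R \<phi>' x)"
      using set_borel_integral_eq_integral(2)[of "{t<..1}" \<phi>']
      by (auto simp: set_lebesgue_integral_def set_integrable_def)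
    then show ?thesis
      unfolding eq by (subst integral_scaleR_left) auto
  next
    case False
    then have "g0 t = 0"
      by (rule g0_out)
    then show ?thesis
      by (simp add: H_def cong: if_cong)
  qed
  have "(LINT x|\<Lambda>. \<phi>' x *\<^sub>R integral {-1..x} g) = (\<integral>x. k x *\<^sub>R integral {-1..x} g \<partial>lborel)"
  proof -
    have c: "continuous_on {-1..1} (\<lambda>x. \<phi>' x *\<^sub>R integral {-1..x} g)"
      using integral_Omega_eq(2)[OF g] cont
      by (intro continuous_intros indefinite_integral_continuous_1) (auto intro: continuous_on_subset)
    have "(LINT x|\<Lambda>. \<phi>' x *\<^sub>R integral {-1..x} g) = integral {-1..1} (\<lambda>x. \<phi>' x *\<^sub>R integral {-1..x} g)"
      by (intro integral_Omega_eq integrable_Omega_continuous c)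
    also have "\<dots> = (\<integral>x. indicator {-1..1} x *\<^sub>R (\<phi>' x *\<^sub>R integral {-1..x} g) \<partial>lborel)"
      using set_borel_integral_eq_integral(2)[OF borel_integrable_atLeastAtMost'[OF c]]
      by (simp add: set_lebesgue_integral_def)
    finally show ?thesis
      by (simp add: k_def)
  qed
  also have "\<dots> = (\<integral>t. - (\<phi> t *\<^sub>R g0 t) \<partial>lborel)"
    using swap by (simp only: inner outer)
  also have "\<dots> = - (\<integral>t. \<phi> t *\<^sub>R g0 t \<partial>lborel)"
    by simp
  also have "(\<integral>t. \<phi> t *\<^sub>R g0 t \<partial>lborel) = (\<integral>t. indicator \<Omega> t *\<^sub>R (\<phi> t *\<^sub>R g0 t) \<partial>lebesgue)"
  proof -
    have "(\<lambda>t. indicator \<Omega> t *\<^sub>R (\<phi> t *\<^sub>R g0 t)) = (\<lambda>t. \<phi> t *\<^sub>R g0 t)"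
      using g0_out by (auto simp: indicator_def fun_eq_iff)
    then show ?thesis
      by (simp add: integral_completion)
  qed
  also have "\<dots> = (LINT t|\<Lambda>. \<phi> t *\<^sub>R g0 t)"
    by (rule integral_restrict_space[symmetric]) auto
  also have "\<dots> = (LINT t|\<Lambda>. \<phi> t *\<^sub>R g t)"
  proof (rule integral_cong_AE)
    show "AE t in \<Lambda>. \<phi> t *\<^sub>R g0 t = \<phi> t *\<^sub>R g t"
      using ae by eventually_elim simp
    show "(\<lambda>t. \<phi> t *\<^sub>R g t) \<in> borel_measurable \<Lambda>" "(\<lambda>t. \<phi> t *\<^sub>R g0 t) \<in> borel_measurable \<Lambda>"
      using integrable_Omega_mult[OF g cont\<phi>] integrable_Omega_mult[OF ig0\<Lambda> cont\<phi>] by auto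
  qed
  finally show ?thesis .
qed

text \<open>f and the primitive of g have the same weak derivative, so
  \<open>du_Bois_Reymond\<close> makes their difference constant.\<close>

lemma weak_deriv_imp_primitive:
  fixes f g :: "real \<Rightarrow> complex"
  assumes f: "integrable \<Lambda> f" and g: "integrable \<Lambda> g" and wd: "is_weak_deriv \<Omega> 1 f g"
  shows "\<exists>c. AE x in \<Lambda>. f x = c + integral {-1..x} g"
proof -
  have cont: "continuous_on {-1..1} (\<lambda>x. integral {-1..x} g)"
    using integral_Omega_eq(2)[OF g] by (rule indefinite_integral_continuous_1)
  have iG: "integrable \<Lambda> (\<lambda>x. integral {-1..x} g)"
    by (rule integrable_Omega_continuous[OF cont])
  have "\<exists>c. AE x in \<Lambda>. f x - integral {-1..x} g = c"
  proof (rule du_Bois_Reymond)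
    show "integrable \<Lambda> (\<lambda>x. f x - integral {-1..x} g)"
      using f iG by auto
    fix \<phi> assume \<phi>: "test_function \<Omega> \<phi>"
    then have sm: "smooth \<phi>" and 1: "\<phi> 1 = 0"
      by (auto simp: test_function_Omega_iff)
    have c: "continuous_on UNIV (deriv \<phi>)"
      by (intro smooth_continuous_on smooth_deriv sm)
    have "(LINT x|\<Lambda>. deriv \<phi> x *\<^sub>R f x) = - (LINT x|\<Lambda>. \<phi> x *\<^sub>R g x)"
      using wd \<phi> by (simp add: is_weak_deriv_def)
    moreover have "(LINT x|\<Lambda>. deriv \<phi> x *\<^sub>R integral {-1..x} g) = - (LINT x|\<Lambda>. \<phi> x *\<^sub>R g x)"
      by (rule integral_by_parts_primitive[OF g smooth_has_deriv[OF sm] c 1])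
    ultimately show "(LINT x|\<Lambda>. deriv \<phi> x *\<^sub>R (f x - integral {-1..x} g)) = 0"
      using integrable_Omega_mult[OF f c] integrable_Omega_mult[OF iG c]
      by (simp add: scaleR_diff_right)
  qed
  then obtain c where "AE x in \<Lambda>. f x - integral {-1..x} g = c" by blast
  then show ?thesis
    by (intro exI[of _ c]) (auto elim!: eventually_mono)
qed

section \<open>Sobolev functions on the interval\<close>

text \<open>The difference has integral 0 over every [-1, y], and differentiating in y recovers its
  values. One-sided derivatives include the endpoints, where the traces are taken.\<close>

lemma continuous_AE_eq:
  fixes v w :: "real \<Rightarrow> complex"
  assumes v: "continuous_on {-1..1} v" and w: "continuous_on {-1..1} w"
    and ae: "AE x in \<Lambda>. v x = w x" and x: "x \<in> {-1..1}"
  shows "v x = w x"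
proof -
  obtain N where N: "N \<in> null_sets lebesgue" "{t. \<not> (t \<in> \<Omega> \<longrightarrow> v t = w t)} \<subseteq> N"
    using ae unfolding AE_Omega_iff by (auto simp: eventually_ae_filter)
  have "integral {-1..y} (\<lambda>t. v t - w t) = 0" if "y \<le> 1" for y
  proof -
    have "integral {-1..y} (\<lambda>t. v t - w t) = integral {-1..y} (\<lambda>t. 0)"
      by (rule integral_spike[of "insert (-1) (insert 1 N)"])
        (use that N in \<open>force simp: negligible_iff_null_sets[symmetric] subset_iff\<close>)+
    then show ?thesis by simp
  qed
  note 0 = this
  have "((\<lambda>y. integral {-1..y} (\<lambda>t. v t - w t)) has_vector_derivative v x - w x) (at x within {-1..1})"
    using v w x by (intro integral_has_vector_derivative continuous_intros)
  moreover have "((\<lambda>y. integral {-1..y} (\<lambda>t. v t - w t)) has_vector_derivative 0) (at x within {-1..1})"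
    by (rule has_vector_derivative_transform[OF x _ has_vector_derivative_const[of 0]]) (simp add: 0)
  ultimately have "v x - w x = 0"
    using vector_derivative_unique_within_closed_interval[of "-1" 1 x] x by fastforce
  then show ?thesis by simp
qed

text \<open>Two continuous representatives agree up to the boundary, so the description
  \<open>THE\<close> denotes the value of any of them.\<close>

lemma trace_at_eqI:
  fixes v w :: "real \<Rightarrow> complex"
  assumes w: "continuous_on {-1..1} w" and ae: "AE t in \<Lambda>. v t = w t" and x: "x \<in> {-1..1}"
  shows "trace_at \<Omega> v x = w x"
proof -
  have cl: "closure \<Omega> = {-1..1}" by (simp add: closure_greaterThanLessThan)
  show ?thesis
    unfolding trace_at_def cl
  proof (rule the_equality)
    show "\<exists>wa. continuous_on {-1..1} wa \<and> (AE t in \<Lambda>. wa t = v t) \<and> wa x = w x"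
      using w ae by (intro exI[of _ w]) (auto elim: eventually_mono)
    fix c assume "\<exists>wa. continuous_on {-1..1} wa \<and> (AE t in \<Lambda>. wa t = v t) \<and> wa x = c"
    then obtain wa where wa: "continuous_on {-1..1} wa" "AE t in \<Lambda>. wa t = v t" "wa x = c"
      by blast
    have "AE t in \<Lambda>. wa t = w t"
      using wa(2) ae by eventually_elim simp
    then show "c = w x"
      using continuous_AE_eq[OF wa(1) w _ x] wa(3) by simp
  qed
qed

lemma square_integrable_imp_integrable:
  assumes "square_integrable_on f \<Omega>"
  shows "integrable \<Lambda> f"
proof (rule Bochner_Integration.integrable_bound)
  have "integrable \<Lambda> (\<lambda>_. 1::real)"
    by (rule integrable_Omega_continuous) auto
  then show "integrable \<Lambda> (\<lambda>x. 1 + (cmod (f x))\<^sup>2)"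
    using assms by (auto simp: square_integrable_on_def)
  show "f \<in> borel_measurable \<Lambda>"
    using assms by (auto simp: square_integrable_on_def)
  have "t \<le> 1 + t\<^sup>2" for t :: real
    
    using zero_le_power2[of "t - 1 / 2"] by (simp add: power2_eq_square algebra_simps)
  then show "AE x in \<Lambda>. norm (f x) \<le> norm (1 + (cmod (f x))\<^sup>2)"
    by (auto intro!: AE_I2)
qed

lemma sobolev_weak_deriv:
  assumes "f \<in> sobolev_space l \<Omega>" "k \<le> l"
  shows "square_integrable_on (weak_deriv \<Omega> k f) \<Omega>" "is_weak_deriv \<Omega> k f (weak_deriv \<Omega> k f)"
    "integrable \<Lambda> (weak_deriv \<Omega> k f)"
proof -
  have "\<exists>g. square_integrable_on g \<Omega> \<and> is_weak_deriv \<Omega> k f g"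
    using assms by (auto simp: sobolev_space_def)
  then have "square_integrable_on (weak_deriv \<Omega> k f) \<Omega> \<and> is_weak_deriv \<Omega> k f (weak_deriv \<Omega> k f)"
    unfolding weak_deriv_def by (rule someI_ex)
  then show "square_integrable_on (weak_deriv \<Omega> k f) \<Omega>" "is_weak_deriv \<Omega> k f (weak_deriv \<Omega> k f)"
    "integrable \<Lambda> (weak_deriv \<Omega> k f)"
    by (auto intro: square_integrable_imp_integrable)
qed

lemma sobolev_integrable: "f \<in> sobolev_space l \<Omega> \<Longrightarrow> integrable \<Lambda> f"
  by (auto simp: sobolev_space_def intro: square_integrable_imp_integrable)

text \<open>The derivative of order 0 is also the result of a choice, so even the L^2 norm must be
  identified through the fundamental lemma.\<close>

lemma weak_deriv_0_AE:
  assumes "f \<in> sobolev_space l \<Omega>"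
  shows "AE x in \<Lambda>. weak_deriv \<Omega> 0 f x = f x"
proof -
  have "AE x in \<Lambda>. weak_deriv \<Omega> 0 f x - f x = 0"
  proof (rule fundamental_lemma)
    note i = sobolev_weak_deriv(3)[OF assms, of 0, simplified] sobolev_integrable[OF assms]
    show "integrable \<Lambda> (\<lambda>x. weak_deriv \<Omega> 0 f x - f x)"
      using i by auto
    fix \<phi> assume \<phi>: "test_function \<Omega> \<phi>"
    then have c: "continuous_on UNIV \<phi>"
      by (auto simp: test_function_Omega_iff intro: smooth_continuous_on)
    show "(LINT x|\<Lambda>. \<phi> x *\<^sub>R (weak_deriv \<Omega> 0 f x - f x)) = 0"
      using sobolev_weak_deriv(2)[OF assms, of 0] \<phi> integrable_Omega_mult[OF i(1) c] integrable_Omega_mult[OF i(2) c]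
      by (simp add: is_weak_deriv_def scaleR_diff_right)
  qed
  then show ?thesis
    by (auto elim: eventually_mono)
qed

lemma test_function_deriv: "test_function \<Omega> \<phi> \<Longrightarrow> test_function \<Omega> (deriv \<phi>)"
proof -
  assume "test_function \<Omega> \<phi>"
  then obtain r where r: "0 \<le> r" "r < 1" "\<And>x. r \<le> \<bar>x\<bar> \<Longrightarrow> \<phi> x = 0" and sm: "smooth \<phi>"
    by (auto simp: test_function_Omega_iff)
  have "deriv \<phi> x = 0" if "(1 + r) / 2 \<le> \<bar>x\<bar>" for x
  proof (rule DERIV_imp_deriv)
    have "x \<in> {y. r < \<bar>y\<bar>}" "open {y::real. r < \<bar>y\<bar>}"
      using that r by (auto intro!: open_Collect_less continuous_intros)
    then have "eventually (\<lambda>y. r < \<bar>y\<bar>) (nhds x)"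
      using eventually_nhds_in_open by fastforce
    then have "eventually (\<lambda>y. \<phi> y = 0) (nhds x)"
      by eventually_elim (simp add: r(3))
    then show "(\<phi> has_field_derivative 0) (at x)"
      by (subst DERIV_cong_ev[where g = "\<lambda>_. 0"]) auto
  qed
  then show ?thesis
    using r smooth_deriv[OF sm] unfolding test_function_Omega_iff
    by (intro conjI exI[of _ "(1 + r) / 2"]) auto
qed

text \<open>The weak derivatives of orders 1 and 2 are chosen independently of each other. Testing
  the first against \<phi>' links them.\<close>

lemma weak_deriv_2_of_1:
  assumes "is_weak_deriv \<Omega> 1 f g" "is_weak_deriv \<Omega> 2 f h"
  shows "is_weak_deriv \<Omega> 1 g h"
  unfolding is_weak_deriv_def
proof (intro allI impI)
  fix \<phi> assume \<phi>: "test_function \<Omega> \<phi>"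
  have "(LINT x|\<Lambda>. deriv (deriv \<phi>) x *\<^sub>R f x) = (LINT x|\<Lambda>. \<phi> x *\<^sub>R h x)"
    using assms(2) \<phi> by (simp add: is_weak_deriv_def numeral_2_eq_2)
  moreover have "(LINT x|\<Lambda>. deriv (deriv \<phi>) x *\<^sub>R f x) = - (LINT x|\<Lambda>. deriv \<phi> x *\<^sub>R g x)"
    using assms(1) test_function_deriv[OF \<phi>] by (simp add: is_weak_deriv_def)
  ultimately show "(LINT x|\<Lambda>. (deriv ^^ 1) \<phi> x *\<^sub>R g x) = (- 1) ^ 1 * (LINT x|\<Lambda>. \<phi> x *\<^sub>R h x)"
    by (simp add: eq_neg_iff_add_eq_0 add_eq_0_iff)
qed

lemma weak_deriv_imp_classical:
  assumes f: "integrable \<Lambda> f" and g: "integrable \<Lambda> g" and wd: "is_weak_deriv \<Omega> 1 f g"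
    and G: "continuous_on {-1..1} G" "AE x in \<Lambda>. g x = G x"
  obtains w where "AE x in \<Lambda>. f x = w x"
    "\<And>x. x \<in> {-1..1} \<Longrightarrow> (w has_vector_derivative G x) (at x within {-1..1})"
proof -
  obtain c where c: "AE x in \<Lambda>. f x = c + integral {-1..x} g"
    using weak_deriv_imp_primitive[OF f g wd] by blast
  obtain N where N: "N \<in> null_sets lebesgue" "{t. \<not> (t \<in> \<Omega> \<longrightarrow> g t = G t)} \<subseteq> N"
    using G(2) unfolding AE_Omega_iff by (auto simp: eventually_ae_filter)
  have eq: "integral {-1..y} g = integral {-1..y} G" if "y \<le> 1" for y
    by (rule integral_spike[of "insert (-1) (insert 1 N)"])
      (use that N in \<open>force simp: negligible_iff_null_sets[symmetric] subset_iff\<close>)+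
  show ?thesis
  proof (rule that[of "\<lambda>x. c + integral {-1..x} G"])
    have "AE x in \<Lambda>. x \<in> \<Omega>"
      by (rule AE_I2) simp
    with c show "AE x in \<Lambda>. f x = c + integral {-1..x} G"
      by eventually_elim (simp add: eq)
    show "((\<lambda>x. c + integral {-1..x} G) has_vector_derivative G x) (at x within {-1..1})" if "x \<in> {-1..1}" for x
      using has_vector_derivative_add[OF has_vector_derivative_const integral_has_vector_derivative[OF G(1) that]]
      by simp
  qed
qed

lemma has_vector_derivative_continuous_on:
  "(\<And>x. x \<in> S \<Longrightarrow> (w has_vector_derivative w' x) (at x within S)) \<Longrightarrow> continuous_on S w"
  using continuous_on_eq_continuous_within has_vector_derivative_continuous by blast

lemma sobolev_2_weak_derivs:
  assumes f: "f \<in> sobolev_space 2 \<Omega>"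
  shows "integrable \<Lambda> f" "integrable \<Lambda> (weak_deriv \<Omega> 1 f)" "integrable \<Lambda> (weak_deriv \<Omega> 2 f)"
    "is_weak_deriv \<Omega> 1 f (weak_deriv \<Omega> 1 f)" "is_weak_deriv \<Omega> 1 (weak_deriv \<Omega> 1 f) (weak_deriv \<Omega> 2 f)"
  using sobolev_integrable[OF f] sobolev_weak_deriv[OF f one_le_numeral] sobolev_weak_deriv[OF f order_refl]
    weak_deriv_2_of_1 by blast+

text \<open>The first derivative is a primitive of the integrable second one, hence continuous; the
  function is in turn a primitive of it.\<close>

lemma sobolev_2_C1:
  assumes f: "f \<in> sobolev_space 2 \<Omega>"
  obtains w w' where "continuous_on {-1..1} w'" "AE x in \<Lambda>. f x = w x" "AE x in \<Lambda>. weak_deriv \<Omega> 1 f x = w' x"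
    "\<And>x. x \<in> {-1..1} \<Longrightarrow> (w has_vector_derivative w' x) (at x within {-1..1})"
proof -
  note d = sobolev_2_weak_derivs[OF f]
  obtain c where c: "AE x in \<Lambda>. weak_deriv \<Omega> 1 f x = c + integral {-1..x} (weak_deriv \<Omega> 2 f)"
    using weak_deriv_imp_primitive[OF d(2,3,5)] by blast
  have cont: "continuous_on {-1..1} (\<lambda>x. c + integral {-1..x} (weak_deriv \<Omega> 2 f))"
    using integral_Omega_eq(2)[OF d(3)] by (intro continuous_intros indefinite_integral_continuous_1)
  show ?thesis
    by (rule weak_deriv_imp_classical[OF d(1,2,4) cont c]) (rule that[OF cont _ c])
qed

text \<open>For a Helmholtz solution the equation itself supplies the continuous second derivative,
  which makes the solution classical.\<close>

lemma sobolev_2_C2: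
  assumes f: "f \<in> sobolev_space 2 \<Omega>" and w'': "continuous_on {-1..1} w''" "AE x in \<Lambda>. weak_deriv \<Omega> 2 f x = w'' x"
  obtains w w' where "AE x in \<Lambda>. f x = w x" "AE x in \<Lambda>. weak_deriv \<Omega> 1 f x = w' x"
    "\<And>x. x \<in> {-1..1} \<Longrightarrow> (w has_vector_derivative w' x) (at x within {-1..1})"
    "\<And>x. x \<in> {-1..1} \<Longrightarrow> (w' has_vector_derivative w'' x) (at x within {-1..1})"
proof -
  note d = sobolev_2_weak_derivs[OF f]
  obtain w' where w': "AE x in \<Lambda>. weak_deriv \<Omega> 1 f x = w' x"
    "\<And>x. x \<in> {-1..1} \<Longrightarrow> (w' has_vector_derivative w'' x) (at x within {-1..1})"
    using weak_deriv_imp_classical[OF d(2,3,5) w''] by metis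
  have c: "continuous_on {-1..1} w'"
    using w'(2) by (rule has_vector_derivative_continuous_on)
  obtain w where "AE x in \<Lambda>. f x = w x"
    "\<And>x. x \<in> {-1..1} \<Longrightarrow> (w has_vector_derivative w' x) (at x within {-1..1})"
    using weak_deriv_imp_classical[OF d(1,2,4) c w'(1)] by metis
  with w' show ?thesis
    using that by blast
qed

section \<open>The Fejer kernel\<close>

lemma integral_eq_on_support:
  fixes q :: "real \<Rightarrow> 'a::banach"
  assumes "\<And>x. 1 \<le> \<bar>x\<bar> \<Longrightarrow> q x = 0" and "a \<le> -1" "1 \<le> b"
  shows "integral {a..b} q = integral {-1..1} q"
proof -
  have "q = (\<lambda>x. if x \<in> {-1..1} then q x else 0)"
    using assms(1) by (auto simp: fun_eq_iff abs_if)
  then have "integral {a..b} q = integral {a..b} (\<lambda>x. if x \<in> {-1..1} then q x else 0)"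
    by simp
  also have "\<dots> = integral ({-1..1} \<inter> {a..b}) q"
    by (rule Henstock_Kurzweil_Integration.integral_restrict_Int)
  also have "{-1..1} \<inter> {a..b} = {-1..1}"
    using assms by auto
  finally show ?thesis .
qed

lemma integral_shift_on_support:
  fixes q :: "real \<Rightarrow> 'a::banach"
  assumes "\<And>x. 1 \<le> \<bar>x\<bar> \<Longrightarrow> q x = 0" and "a + h \<le> -1" "1 \<le> b + h"
  shows "integral {a..b} (\<lambda>x. q (x + h)) = integral {-1..1} q"
  using integral_shift_real_ivl[of "a + h" h "b + h" q] integral_eq_on_support[OF assms] by simp

text \<open>Nonnegativity of the variance: the mean m is subtracted before squaring.\<close>

lemma integral_square_le:
  fixes q :: "real \<Rightarrow> real"
  assumes "continuous_on {0..1} q"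
  shows "(integral {0..1} q)\<^sup>2 \<le> integral {0..1} (\<lambda>s. (q s)\<^sup>2)"
proof -
  define m where "m = integral {0..1} q"
  have i: "q integrable_on {0..1}" "(\<lambda>s. (q s)\<^sup>2) integrable_on {0..1}"
    using assms by (auto intro!: integrable_continuous_real continuous_intros)
  have "0 \<le> integral {0..1} (\<lambda>s. (q s - m)\<^sup>2)"
    by (rule Henstock_Kurzweil_Integration.integral_nonneg)
      (auto intro!: integrable_continuous_real continuous_intros assms)
  also have "(\<lambda>s. (q s - m)\<^sup>2) = (\<lambda>s. (q s)\<^sup>2 - 2 * m * q s + m\<^sup>2)"
    by (auto simp: power2_eq_square algebra_simps)
  also have "integral {0..1} \<dots> = integral {0..1} (\<lambda>s. (q s)\<^sup>2) - 2 * m * m + m\<^sup>2"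
    unfolding m_def using i
    by (subst integral_add integral_diff, auto intro!: integrable_diff integrable_on_mult_right)+
  finally show ?thesis
    by (simp add: m_def power2_eq_square)
qed

text \<open>The integral of (1 - \<bar>\<alpha>\<bar>/k) e^(i \<alpha> h) over [-k, k], folded onto
  [0, k]; this is 2 pi times the Fejer kernel of unit mass.\<close>

definition fejer :: "real \<Rightarrow> real \<Rightarrow> real" where
  "fejer k h = integral {0..k} (\<lambda>\<alpha>. 2 * (1 - \<alpha> / k) * cos (\<alpha> * h))"

text \<open>Integration by parts gives the antiderivative 2 (1 - \<alpha>/k) sin(\<alpha> h)/h - 2
  cos(\<alpha> h)/(k h^2). The closed form shows the positivity and the decay of order 1/(k
  h^2).\<close>

lemma fejer_eq:
  assumes "k > 0" "h \<noteq> 0"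
  shows "fejer k h = 2 * (1 - cos (k * h)) / (k * h\<^sup>2)"
proof -
  have "((\<lambda>\<alpha>. 2 * (1 - \<alpha> / k) * cos (\<alpha> * h)) has_integral
      ((2 * (1 - k / k) * sin (k * h) / h - 2 * cos (k * h) / (k * h\<^sup>2)) -
       (2 * (1 - 0 / k) * sin (0 * h) / h - 2 * cos (0 * h) / (k * h\<^sup>2)))) {0..k}"
    using assms
    by (intro fundamental_theorem_of_calculus)
      (auto intro!: derivative_eq_intros simp: has_real_derivative_iff_has_vector_derivative[symmetric] field_simps power2_eq_square)
  then show ?thesis
    using assms by (simp add: fejer_def integral_unique diff_divide_distrib right_diff_distrib)
qed

lemma fejer_continuous: "continuous_on S (fejer k)"
proof -
  have "continuous_on UNIV (\<lambda>h. integral (cbox 0 k) (\<lambda>\<alpha>. 2 * (1 - \<alpha> / k) * cos (\<alpha> * h)))"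
    by (rule integral_continuous_on_param) (auto intro!: continuous_intros simp: split_beta divide_inverse)
  then show ?thesis
    using continuous_on_subset by (fastforce simp: fejer_def[abs_def])
qed

lemma fejer_nonneg: "k > 0 \<Longrightarrow> 0 \<le> fejer k h"
proof (cases "h = 0")
  case True
  assume "k > 0"
  then show ?thesis
    unfolding fejer_def True
    by (intro Henstock_Kurzweil_Integration.integral_nonneg integrable_continuous_real)
      (auto intro!: continuous_intros simp: pos_divide_le_eq)
qed (simp add: fejer_eq)

lemma fejer_le: "k > 0 \<Longrightarrow> fejer k h * h\<^sup>2 \<le> 4 / k"
proof (cases "h = 0")
  case False
  assume k: "k > 0"
  have "2 * (1 - cos (k * h)) \<le> 4"
    using cos_ge_minus_one[of "k * h"] by argo
  then show ?thesis
    using k False by (simp add: fejer_eq divide_right_mono)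
qed simp

text \<open>Here \<bar>\<alpha> h\<bar> \<le> 1, so the cosine is at least 1/2 and the integrand
  dominates 1 - \<alpha>/k, whose integral is k/2.\<close>

lemma fejer_ge:
  assumes "k > 0" "\<bar>h\<bar> \<le> 1 / k"
  shows "k / 2 \<le> fejer k h"
proof -
  have "((\<lambda>\<alpha>. 1 - \<alpha> / k) has_integral ((k - k\<^sup>2 / (2 * k)) - (0 - 0\<^sup>2 / (2 * k)))) {0..k}"
    using assms
    by (intro fundamental_theorem_of_calculus)
      (auto intro!: derivative_eq_intros simp: has_real_derivative_iff_has_vector_derivative[symmetric] field_simps)
  then have "((\<lambda>\<alpha>. 1 - \<alpha> / k) has_integral k / 2) {0..k}"
    using assms by (simp add: power2_eq_square)
  moreover have "((\<lambda>\<alpha>. 2 * (1 - \<alpha> / k) * cos (\<alpha> * h)) has_integral fejer k h) {0..k}"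
    unfolding fejer_def using assms
    by (intro integrable_integral integrable_continuous_real) (auto intro!: continuous_intros)
  moreover have "1 - \<alpha> / k \<le> 2 * (1 - \<alpha> / k) * cos (\<alpha> * h)" if "\<alpha> \<in> {0..k}" for \<alpha>
  proof -
    have "\<bar>\<alpha> * h\<bar> \<le> k * (1 / k)"
      unfolding abs_mult using that assms by (intro mult_mono) auto
    then have t: "\<bar>\<alpha> * h\<bar> \<le> 1"
      using assms by simp
    have "(sin (\<alpha> * h / 2))\<^sup>2 \<le> (\<alpha> * h / 2)\<^sup>2"
      using abs_sin_x_le_abs_x[of "\<alpha> * h / 2"] by (simp only: abs_le_square_iff)
    also have "\<dots> \<le> (1 / 2)\<^sup>2"
      using t by (subst abs_le_square_iff[symmetric]) auto
    finally have "1 / 2 \<le> cos (\<alpha> * h)"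
      using cos_double_sin[of "\<alpha> * h / 2"] by (simp add: power2_eq_square)
    then have "(1 - \<alpha> / k) * 1 \<le> (1 - \<alpha> / k) * (2 * cos (\<alpha> * h))"
      using that assms by (intro mult_left_mono) auto
    then show ?thesis
      by (simp only: mult_1_right mult.assoc mult.left_commute)
  qed
  ultimately show ?thesis
    by (rule has_integral_le)
qed

section \<open>Autocorrelation and power spectrum of a real C^1 function supported in
  [-1, 1]\<close>

locale compact_C1 =
  fixes p p' :: "real \<Rightarrow> real"
  assumes p_deriv: "\<And>x. (p has_real_derivative p' x) (at x)"
    and p'_cont: "continuous_on UNIV p'"
    and p_0: "\<And>x. 1 \<le> \<bar>x\<bar> \<Longrightarrow> p x = 0" and p'_0: "\<And>x. 1 \<le> \<bar>x\<bar> \<Longrightarrow> p' x = 0"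
begin

definition autocorr :: "real \<Rightarrow> real" where
  "autocorr h = integral {-1..1} (\<lambda>x. p (x + h) * p x)"

lemma p_cont: "continuous_on S p"
  using p_deriv by (meson DERIV_isCont continuous_at_imp_continuous_on)

lemma p_cont_comp [continuous_intros]:
  "continuous_on S g \<Longrightarrow> continuous_on S (\<lambda>x. p (g x))"
  by (rule continuous_on_compose2[OF p_cont[of UNIV]]) auto

lemma p'_cont_comp [continuous_intros]:
  "continuous_on S g \<Longrightarrow> continuous_on S (\<lambda>x. p' (g x))"
  by (rule continuous_on_compose2[OF p'_cont]) auto

lemma autocorr_continuous: "continuous_on S autocorr"
proof -
  have "continuous_on UNIV (\<lambda>h. integral (cbox (-1) 1) (\<lambda>x. p (x + h) * p x))"
    by (rule integral_continuous_on_param) (auto intro!: continuous_intros simp: split_beta)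
  then show ?thesis
    using continuous_on_subset by (fastforce simp: autocorr_def[abs_def])
qed

text \<open>The interval [-3, 3] contains the supports of p and of its translate by \<bar>h\<bar>
  \<le> 2. The choice c = -1 ties the autocorrelation to the translation error, c = 1 bounds it
  below by minus the energy.\<close>

lemma autocorr_expand:
  assumes h: "\<bar>h\<bar> \<le> 2"
  shows "integral {-3..3} (\<lambda>x. (p (x + h) + c * p x)\<^sup>2) =
    (1 + c\<^sup>2) * integral {-1..1} (\<lambda>x. (p x)\<^sup>2) + 2 * c * autocorr h"
proof -
  have i: "(\<lambda>x. (p (x + h))\<^sup>2) integrable_on {-3..3}" "(\<lambda>x. (p x)\<^sup>2) integrable_on {-3..3}"
    "(\<lambda>x. p (x + h) * p x) integrable_on {-3..3}"
    by (auto intro!: integrable_continuous_real continuous_intros)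
  have "(\<lambda>x. (p (x + h) + c * p x)\<^sup>2) = (\<lambda>x. ((p (x + h))\<^sup>2 + c\<^sup>2 * (p x)\<^sup>2) + 2 * c * (p (x + h) * p x))"
    by (auto simp: power2_eq_square algebra_simps)
  then have "integral {-3..3} (\<lambda>x. (p (x + h) + c * p x)\<^sup>2) =
      (integral {-3..3} (\<lambda>x. (p (x + h))\<^sup>2) + c\<^sup>2 * integral {-3..3} (\<lambda>x. (p x)\<^sup>2))
      + 2 * c * integral {-3..3} (\<lambda>x. p (x + h) * p x)"
    using i by (simp add: integral_add integrable_add integrable_on_mult_right del: mult_eq_0_iff)
  moreover have "integral {-3..3} (\<lambda>x. (p (x + h))\<^sup>2) = integral {-1..1} (\<lambda>x. (p x)\<^sup>2)"
    using h by (intro integral_shift_on_support[where q = "\<lambda>x. (p x)\<^sup>2"]) (auto simp: p_0)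
  moreover have "integral {-3..3} (\<lambda>x. (p x)\<^sup>2) = integral {-1..1} (\<lambda>x. (p x)\<^sup>2)"
    by (intro integral_eq_on_support) (auto simp: p_0)
  moreover have "integral {-3..3} (\<lambda>x. p (x + h) * p x) = autocorr h"
    unfolding autocorr_def by (intro integral_eq_on_support) (auto simp: p_0)
  ultimately show ?thesis
    by (simp add: algebra_simps)
qed

text \<open>The increment is h times the average of p' along the segment from x to x + h. Jensen
  moves the square inside, and after exchanging the integrals each translate of p' has the same
  energy.\<close>

lemma translation_bound:
  assumes h: "\<bar>h\<bar> \<le> 2"
  shows "integral {-3..3} (\<lambda>x. (p (x + h) - p x)\<^sup>2) \<le> h\<^sup>2 * integral {-1..1} (\<lambda>x. (p' x)\<^sup>2)"
proof -
  have eq: "p (x + h) - p x = h * integral {0..1} (\<lambda>s. p' (x + s * h))" for x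
  proof -
    have "((\<lambda>s. p' (x + s * h) * h) has_integral (p (x + 1 * h) - p (x + 0 * h))) {0..1}"
    proof (rule fundamental_theorem_of_calculus)
      fix s :: real
      have "((\<lambda>s. p (x + s * h)) has_real_derivative p' (x + s * h) * h) (at s)"
        by (rule DERIV_chain2[OF p_deriv]) (auto intro!: derivative_eq_intros)
      then show "((\<lambda>s. p (x + s * h)) has_vector_derivative p' (x + s * h) * h) (at s within {0..1})"
        by (simp add: has_real_derivative_iff_has_vector_derivative has_vector_derivative_at_within)
    qed simp
    then have "integral {0..1} (\<lambda>s. p' (x + s * h) * h) = p (x + 1 * h) - p (x + 0 * h)"
      by (rule integral_unique)
    then show ?thesis
      by (simp add: mult.commute)
  qed
  have pt: "(p (x + h) - p x)\<^sup>2 \<le> h\<^sup>2 * integral {0..1} (\<lambda>s. (p' (x + s * h))\<^sup>2)" for x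
    unfolding eq power_mult_distrib
    by (intro mult_left_mono integral_square_le) (auto intro!: continuous_intros)
  have cont: "continuous_on (cbox (-3, 0) (3, 1)) (\<lambda>(x, s). (p' (x + s * h))\<^sup>2)"
    by (auto intro!: continuous_intros simp: split_beta)
  have "continuous_on UNIV (\<lambda>x. integral (cbox 0 1) (\<lambda>s. (p' (x + s * h))\<^sup>2))"
    by (rule integral_continuous_on_param) (auto intro!: continuous_intros simp: split_beta)
  then have cont': "continuous_on {-3..3} (\<lambda>x. integral {0..1} (\<lambda>s. (p' (x + s * h))\<^sup>2))"
    by (auto intro: continuous_on_subset)
  then have "(\<lambda>x. h\<^sup>2 * integral {0..1} (\<lambda>s. (p' (x + s * h))\<^sup>2)) integrable_on {-3..3}"
    by (intro integrable_continuous_real continuous_intros) (auto intro: continuous_on_subset)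
  then have "integral {-3..3} (\<lambda>x. (p (x + h) - p x)\<^sup>2) \<le>
      integral {-3..3} (\<lambda>x. h\<^sup>2 * integral {0..1} (\<lambda>s. (p' (x + s * h))\<^sup>2))"
    by (intro integral_le pt integrable_continuous_real) (auto intro!: continuous_intros cont')
  also have "\<dots> = h\<^sup>2 * integral {-3..3} (\<lambda>x. integral {0..1} (\<lambda>s. (p' (x + s * h))\<^sup>2))"
    by simp
  also have "integral {-3..3} (\<lambda>x. integral {0..1} (\<lambda>s. (p' (x + s * h))\<^sup>2)) =
      integral {0..1} (\<lambda>s. integral {-3..3} (\<lambda>x. (p' (x + s * h))\<^sup>2))"
    using integral_swap_continuous[OF cont] by simp
  also have "\<dots> = integral {0..1} (\<lambda>s::real. integral {-1..1} (\<lambda>x. (p' x)\<^sup>2))"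
  proof (rule Henstock_Kurzweil_Integration.integral_cong)
    fix s :: real assume "s \<in> {0..1}"
    then have "\<bar>s * h\<bar> \<le> 1 * 2"
      unfolding abs_mult using h by (intro mult_mono) auto
    then show "integral {-3..3} (\<lambda>x. (p' (x + s * h))\<^sup>2) = integral {-1..1} (\<lambda>x. (p' x)\<^sup>2)"
      by (intro integral_shift_on_support[where q = "\<lambda>x. (p' x)\<^sup>2"]) (auto simp: p'_0)
  qed
  finally show ?thesis by simp
qed

lemma autocorr_ge:
  assumes h: "\<bar>h\<bar> \<le> 2"
  shows "integral {-1..1} (\<lambda>x. (p x)\<^sup>2) - h\<^sup>2 * integral {-1..1} (\<lambda>x. (p' x)\<^sup>2) / 2 \<le> autocorr h"
    "- integral {-1..1} (\<lambda>x. (p x)\<^sup>2) \<le> autocorr h"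
proof -
  show "integral {-1..1} (\<lambda>x. (p x)\<^sup>2) - h\<^sup>2 * integral {-1..1} (\<lambda>x. (p' x)\<^sup>2) / 2 \<le> autocorr h"
    using translation_bound[OF h] autocorr_expand[OF h, of "-1"] by (simp add: power2_eq_square)
  have "0 \<le> integral {-3..3} (\<lambda>x. (p (x + h) + 1 * p x)\<^sup>2)"
    by (rule Henstock_Kurzweil_Integration.integral_nonneg)
      (auto intro!: integrable_continuous_real continuous_intros)
  then show "- integral {-1..1} (\<lambda>x. (p x)\<^sup>2) \<le> autocorr h"
    using autocorr_expand[OF h, of 1] by simp
qed

definition cos_transform :: "real \<Rightarrow> real" where
  "cos_transform \<alpha> = integral {-1..1} (\<lambda>x. p x * cos (\<alpha> * x))"

definition sin_transform :: "real \<Rightarrow> real" where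
  "sin_transform \<alpha> = integral {-1..1} (\<lambda>x. p x * sin (\<alpha> * x))"

text \<open>The Wiener-Khinchin relation: put y = x + h in the double integral and apply the
  addition formula to cos(\<alpha> (y - x)).\<close>

lemma power_spectrum_eq:
  "(cos_transform \<alpha>)\<^sup>2 + (sin_transform \<alpha>)\<^sup>2 = integral {-2..2} (\<lambda>h. autocorr h * cos (\<alpha> * h))"
proof -
  have i: "(\<lambda>x. p x * cos (\<alpha> * x)) integrable_on {-1..1}" "(\<lambda>x. p x * sin (\<alpha> * x)) integrable_on {-1..1}"
    by (auto intro!: integrable_continuous_real continuous_intros)
  have inner: "cos (\<alpha> * x) * cos_transform \<alpha> + sin (\<alpha> * x) * sin_transform \<alpha> =
      integral {-2..2} (\<lambda>h. p (x + h) * cos (\<alpha> * h))" if "x \<in> {-1..1}" for x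
  proof -
    have "integral {-2..2} (\<lambda>h. p (h + x) * cos (\<alpha> * (h + x - x))) = integral {-1..1} (\<lambda>y. p y * cos (\<alpha> * (y - x)))"
      using that by (intro integral_shift_on_support[where q = "\<lambda>y. p y * cos (\<alpha> * (y - x))"]) (auto simp: p_0)
    then have *: "integral {-2..2} (\<lambda>h. p (x + h) * cos (\<alpha> * h)) = integral {-1..1} (\<lambda>y. p y * cos (\<alpha> * (y - x)))"
      by (simp add: add.commute)
    note *
    also have "(\<lambda>y. p y * cos (\<alpha> * (y - x))) =
        (\<lambda>y. cos (\<alpha> * x) * (p y * cos (\<alpha> * y)) + sin (\<alpha> * x) * (p y * sin (\<alpha> * y)))"
      by (auto simp: right_diff_distrib cos_diff algebra_simps)
    also have "integral {-1..1} \<dots> = cos (\<alpha> * x) * cos_transform \<alpha> + sin (\<alpha> * x) * sin_transform \<alpha>"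
      unfolding cos_transform_def sin_transform_def using i
      by (subst integral_add) (auto intro: integrable_on_mult_right)
    finally show ?thesis by simp
  qed
  have "(cos_transform \<alpha>)\<^sup>2 + (sin_transform \<alpha>)\<^sup>2 =
      integral {-1..1} (\<lambda>x. p x * cos (\<alpha> * x)) * cos_transform \<alpha> + integral {-1..1} (\<lambda>x. p x * sin (\<alpha> * x)) * sin_transform \<alpha>"
    by (simp add: cos_transform_def sin_transform_def power2_eq_square)
  also have "\<dots> = integral {-1..1} (\<lambda>x. p x * cos (\<alpha> * x) * cos_transform \<alpha> + p x * sin (\<alpha> * x) * sin_transform \<alpha>)"
    using i by (subst integral_add) (auto intro: integrable_on_mult_left)
  also have "\<dots> = integral {-1..1} (\<lambda>x. integral {-2..2} (\<lambda>h. p (x + h) * p x * cos (\<alpha> * h)))"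
  proof (rule Henstock_Kurzweil_Integration.integral_cong)
    fix x :: real assume "x \<in> {-1..1}"
    have "p x * cos (\<alpha> * x) * cos_transform \<alpha> + p x * sin (\<alpha> * x) * sin_transform \<alpha> =
        p x * (cos (\<alpha> * x) * cos_transform \<alpha> + sin (\<alpha> * x) * sin_transform \<alpha>)"
      by (simp add: algebra_simps)
    also have "\<dots> = integral {-2..2} (\<lambda>h. p x * (p (x + h) * cos (\<alpha> * h)))"
      using inner[OF \<open>x \<in> _\<close>] by simp
    finally show "p x * cos (\<alpha> * x) * cos_transform \<alpha> + p x * sin (\<alpha> * x) * sin_transform \<alpha> =
        integral {-2..2} (\<lambda>h. p (x + h) * p x * cos (\<alpha> * h))"
      by (simp only: mult_ac)
  qed
  also have "\<dots> = integral {-2..2} (\<lambda>h. integral {-1..1} (\<lambda>x. p (x + h) * p x * cos (\<alpha> * h)))"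
  proof -
    have "continuous_on (cbox (-1, -2) (1, 2)) (\<lambda>(x, h). p (x + h) * p x * cos (\<alpha> * h))"
      by (auto intro!: continuous_intros simp: split_beta)
    from integral_swap_continuous[OF this] show ?thesis by simp
  qed
  finally show ?thesis
    by (simp add: autocorr_def)
qed

lemma cos_sin_transform_continuous: "continuous_on S cos_transform" "continuous_on S sin_transform"
proof -
  have "continuous_on UNIV (\<lambda>\<alpha>. integral (cbox (-1) 1) (\<lambda>x. p x * cos (\<alpha> * x)))"
    "continuous_on UNIV (\<lambda>\<alpha>. integral (cbox (-1) 1) (\<lambda>x. p x * sin (\<alpha> * x)))"
    by (rule integral_continuous_on_param; auto intro!: continuous_intros simp: split_beta)+
  then show "continuous_on S cos_transform" "continuous_on S sin_transform"
    using continuous_on_subset by (force simp: cos_transform_def[abs_def] sin_transform_def[abs_def])+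
qed

lemma fejer_autocorr_le:
  assumes k: "k > 0"
  shows "integral {-2..2} (\<lambda>h. autocorr h * fejer k h) \<le>
    integral {0..k} (\<lambda>\<alpha>. 2 * ((cos_transform \<alpha>)\<^sup>2 + (sin_transform \<alpha>)\<^sup>2))"
proof -
  have "integral {-2..2} (\<lambda>h. autocorr h * fejer k h) =
      integral {-2..2} (\<lambda>h. integral {0..k} (\<lambda>\<alpha>. autocorr h * (2 * (1 - \<alpha> / k) * cos (\<alpha> * h))))"
    by (simp add: fejer_def)
  also have "\<dots> = integral {0..k} (\<lambda>\<alpha>. integral {-2..2} (\<lambda>h. autocorr h * (2 * (1 - \<alpha> / k) * cos (\<alpha> * h))))"
  proof -
    have "continuous_on (cbox (-2, 0) (2, k)) (\<lambda>(h, \<alpha>). autocorr h * (2 * (1 - \<alpha> / k) * cos (\<alpha> * h)))"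
      by (auto intro!: continuous_intros continuous_on_compose2[OF autocorr_continuous[of UNIV]]
          simp: split_beta divide_inverse)
    from integral_swap_continuous[OF this] show ?thesis by simp
  qed
  also have "\<dots> = integral {0..k} (\<lambda>\<alpha>. (1 - \<alpha> / k) * (2 * ((cos_transform \<alpha>)\<^sup>2 + (sin_transform \<alpha>)\<^sup>2)))"
  proof (rule Henstock_Kurzweil_Integration.integral_cong)
    fix \<alpha>
    have "(\<lambda>h. autocorr h * (2 * (1 - \<alpha> / k) * cos (\<alpha> * h))) =
        (\<lambda>h. (2 * (1 - \<alpha> / k)) * (autocorr h * cos (\<alpha> * h)))"
      by (auto simp: mult_ac)
    then show "integral {-2..2} (\<lambda>h. autocorr h * (2 * (1 - \<alpha> / k) * cos (\<alpha> * h))) =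
        (1 - \<alpha> / k) * (2 * ((cos_transform \<alpha>)\<^sup>2 + (sin_transform \<alpha>)\<^sup>2))"
      by (simp only: integral_mult_right power_spectrum_eq) simp
  qed
  also have "\<dots> \<le> integral {0..k} (\<lambda>\<alpha>. 2 * ((cos_transform \<alpha>)\<^sup>2 + (sin_transform \<alpha>)\<^sup>2))"
  proof (rule integral_le)
    fix \<alpha> assume "\<alpha> \<in> {0..k}"
    then show "(1 - \<alpha> / k) * (2 * ((cos_transform \<alpha>)\<^sup>2 + (sin_transform \<alpha>)\<^sup>2)) \<le>
        2 * ((cos_transform \<alpha>)\<^sup>2 + (sin_transform \<alpha>)\<^sup>2)"
      using k by (intro mult_left_le_one_le) auto
  qed (use k in \<open>auto intro!: integrable_continuous_real continuous_intros cos_sin_transform_continuous\<close>)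
  finally show ?thesis .
qed

text \<open>Within 1/k of 0 the kernel has mass at least 1 and the autocorrelation is nearly N. Far
  out the autocorrelation is at least -N and the kernel is O(1/(k h^2)), so the two tails together
  cost at most N/2.\<close>

lemma fejer_autocorr_ge:
  assumes k: "k > 8"
  defines "N \<equiv> integral {-1..1} (\<lambda>x. (p x)\<^sup>2)" and "B \<equiv> integral {-1..1} (\<lambda>x. (p' x)\<^sup>2)"
  shows "N / 2 - 64 * B / k\<^sup>2 \<le> integral {-2..2} (\<lambda>h. autocorr h * fejer k h)"
proof -
  \<comment> \<open>Each tail costs at most 4 N/(k r), which is N/4 for this r; the condition k > 8
    says r < 2.\<close>
  define r where "r = 16 / k"
  have r: "1 / k \<le> r" "0 < r" "r < 2"
    using k by (auto simp: r_def field_simps)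
  have N: "N \<ge> 0" and B: "B \<ge> 0"
    unfolding N_def B_def
    by (rule Henstock_Kurzweil_Integration.integral_nonneg; auto intro!: integrable_continuous_real continuous_intros)+
  define \<psi> where "\<psi> h = autocorr h * fejer k h" for h
  have c: "continuous_on S \<psi>" for S
    unfolding \<psi>_def by (intro continuous_intros autocorr_continuous fejer_continuous)
  have i: "\<psi> integrable_on {a..b}" for a b
    by (intro integrable_continuous_real c)
  \<comment> \<open>The loss h^2 B/2 in the autocorrelation is multiplied by a kernel of size at
    most 4/(k h^2), so it stays below 2 B/k for all h.\<close>
  have near: "N * fejer k h \<le> \<psi> h + 2 * B / k" if "\<bar>h\<bar> \<le> 2" for h
  proof -
    have "(N - h\<^sup>2 * B / 2) * fejer k h \<le> \<psi> h"
      unfolding \<psi>_def using autocorr_ge(1)[OF that] k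
      by (intro mult_right_mono fejer_nonneg) (auto simp: N_def B_def)
    moreover have "B / 2 * (fejer k h * h\<^sup>2) \<le> B / 2 * (4 / k)"
      using B k by (intro mult_left_mono fejer_le) auto
    moreover have "(N - h\<^sup>2 * B / 2) * fejer k h = N * fejer k h - B / 2 * (fejer k h * h\<^sup>2)"
      by (simp add: algebra_simps)
    moreover have "B / 2 * (4 / k) = 2 * B / k"
      by simp
    ultimately show ?thesis by argo
  qed
  have far: "- (4 * N / k) * (1 / h\<^sup>2) \<le> \<psi> h" if "\<bar>h\<bar> \<le> 2" "h \<noteq> 0" for h
  proof -
    have "- N * fejer k h \<le> \<psi> h"
      unfolding \<psi>_def using autocorr_ge(2)[OF that(1)] k
      by (intro mult_right_mono fejer_nonneg) (auto simp: N_def)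
    moreover have "N * fejer k h \<le> N * (4 / k / h\<^sup>2)"
      using N k fejer_le[of k h] that by (intro mult_left_mono) (auto simp: pos_le_divide_eq mult_ac)
    ultimately show ?thesis
      by (simp add: field_simps)
  qed
  have mid: "N - 4 * r * B / k \<le> integral {-r..r} \<psi>"
  proof -
    have "N = integral {-(1/k)..1/k} (\<lambda>_. N * k / 2)"
      using k by simp
    also have "\<dots> \<le> integral {-(1/k)..1/k} (\<lambda>h. \<psi> h + 2 * B / k)"
    proof (rule integral_le)
      fix h assume h: "h \<in> {-(1/k)..1/k}"
      then have "\<bar>h\<bar> \<le> 1 / k" by auto
      then have "N * (k / 2) \<le> N * fejer k h"
        using N k by (intro mult_left_mono fejer_ge) auto
      moreover have "\<bar>h\<bar> \<le> 2"
        using \<open>\<bar>h\<bar> \<le> 1 / k\<close> r by linarith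
      ultimately show "N * k / 2 \<le> \<psi> h + 2 * B / k"
        using near[of h] by argo
    qed (auto intro!: integrable_continuous_real continuous_intros c)
    \<comment> \<open>With 2 B/k added, the integrand dominates N times the kernel and is
      nonnegative, so the interval may be enlarged.\<close>
    also have "\<dots> \<le> integral {-r..r} (\<lambda>h. \<psi> h + 2 * B / k)"
    proof (rule integral_subset_le)
      have "0 \<le> \<psi> h + 2 * B / k" if "h \<in> {-r..r}" for h
      proof -
        have "N * fejer k h \<le> \<psi> h + 2 * B / k"
          using r that by (intro near) auto
        moreover have "0 \<le> N * fejer k h"
          using N k by (intro mult_nonneg_nonneg fejer_nonneg) auto
        ultimately show ?thesis by linarith
      qed
      then show "\<forall>h\<in>{-r..r}. 0 \<le> \<psi> h + 2 * B / k" by blast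
    qed (use r in \<open>auto intro!: integrable_continuous_real continuous_intros c\<close>)
    also have "\<dots> = integral {-r..r} \<psi> + 4 * r * B / k"
      using r i by (subst integral_add) auto
    finally show ?thesis by simp
  qed
  have tail: "((\<lambda>h. - (4 * N / k) * (1 / h\<^sup>2)) has_integral (- (4 * N / k) * (1 / r - 1 / 2))) {r..2}"
    "((\<lambda>h. - (4 * N / k) * (1 / h\<^sup>2)) has_integral (- (4 * N / k) * (1 / r - 1 / 2))) {-2..-r}"
  proof -
    have "((\<lambda>h::real. 1 / h\<^sup>2) has_integral (- 1 / 2 - - 1 / r)) {r..2}"
      using r by (intro fundamental_theorem_of_calculus)
       (auto intro!: derivative_eq_intros simp: has_real_derivative_iff_has_vector_derivative[symmetric] power2_eq_square)
    from has_integral_mult_right[OF this, of "- (4 * N / k)"]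
    show "((\<lambda>h. - (4 * N / k) * (1 / h\<^sup>2)) has_integral (- (4 * N / k) * (1 / r - 1 / 2))) {r..2}"
      by simp
    have "((\<lambda>h::real. 1 / h\<^sup>2) has_integral (- 1 / (-r) - - 1 / (-2))) {-2..-r}"
      using r by (intro fundamental_theorem_of_calculus)
       (auto intro!: derivative_eq_intros simp: has_real_derivative_iff_has_vector_derivative[symmetric] power2_eq_square)
    from has_integral_mult_right[OF this, of "- (4 * N / k)"]
    show "((\<lambda>h. - (4 * N / k) * (1 / h\<^sup>2)) has_integral (- (4 * N / k) * (1 / r - 1 / 2))) {-2..-r}"
      by simp
  qed
  have tail_ge: "- (N / 4) \<le> - (4 * N / k) * (1 / r - 1 / 2)"
    using N k by (simp add: r_def field_simps)
  have "- (N / 4) \<le> integral {r..2} \<psi>"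
    by (rule order_trans[OF tail_ge has_integral_le[OF tail(1) integrable_integral[OF i] far]]) (use r in auto)
  moreover have "- (N / 4) \<le> integral {-2..-r} \<psi>"
    by (rule order_trans[OF tail_ge has_integral_le[OF tail(2) integrable_integral[OF i] far]]) (use r in auto)
  moreover have "integral {-2..-r} \<psi> + integral {-r..r} \<psi> + integral {r..2} \<psi> = integral {-2..2} \<psi>"
    using r Henstock_Kurzweil_Integration.integral_combine[of "-2" "-r" r \<psi>]
      Henstock_Kurzweil_Integration.integral_combine[of "-2" r 2 \<psi>] i by auto
  moreover have "4 * r * B / k = 64 * B / k\<^sup>2"
    by (simp add: r_def power2_eq_square)
  ultimately show ?thesis
    using mid unfolding \<psi>_def[abs_def] by linarith
qed

text \<open>Doubling the comparison for k > 8 produces the constants 2 and 128. For k \<le> 8 the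
  term 128 N/k^2 alone exceeds N, because k^2 \<le> 64.\<close>

lemma fejer_inequality:
  assumes k: "k > 0"
  defines "N \<equiv> integral {-1..1} (\<lambda>x. (p x)\<^sup>2)" and "B \<equiv> integral {-1..1} (\<lambda>x. (p' x)\<^sup>2)"
  shows "N \<le> 2 * integral {0..k} (\<lambda>\<alpha>. 2 * ((cos_transform \<alpha>)\<^sup>2 + (sin_transform \<alpha>)\<^sup>2)) + 128 * (N + B) / k\<^sup>2"
proof (cases "k > 8")
  case True
  have "N \<ge> 0"
    unfolding N_def
    by (rule Henstock_Kurzweil_Integration.integral_nonneg; auto intro!: integrable_continuous_real continuous_intros)
  then have "0 \<le> 128 * N / k\<^sup>2" by simp
  then show ?thesis
    using fejer_autocorr_ge[OF True] fejer_autocorr_le[OF k]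
    by (simp add: N_def B_def add_divide_distrib distrib_left)
next
  case False
  have nn: "N \<ge> 0" "B \<ge> 0" "0 \<le> integral {0..k} (\<lambda>\<alpha>. 2 * ((cos_transform \<alpha>)\<^sup>2 + (sin_transform \<alpha>)\<^sup>2))"
    unfolding N_def B_def
    by (rule Henstock_Kurzweil_Integration.integral_nonneg;
      auto intro!: integrable_continuous_real continuous_intros cos_sin_transform_continuous)+
  have "k\<^sup>2 \<le> 8\<^sup>2"
    using False k by (intro power_mono) auto
  then have "N * k\<^sup>2 \<le> N * 64"
    using nn by (intro mult_left_mono) auto
  then have "N * k\<^sup>2 \<le> 128 * (N + B)"
    using nn by argo
  then have "N \<le> 128 * (N + B) / k\<^sup>2"
    using k by (simp add: pos_le_divide_eq)
  then show ?thesis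
    using nn by linarith
qed

end

section \<open>Extrapolation of the Fourier transform\<close>

lemma norm_cis_minus_1_le: "cmod (cis t - 1) \<le> \<bar>t\<bar>"
proof -
  have "(cmod (cis t - 1))\<^sup>2 = (cos t - 1)\<^sup>2 + (sin t)\<^sup>2"
    by (simp add: cmod_power2)
  also have "\<dots> = 2 - 2 * cos t"
    using sin_cos_squared_add[of t] by (simp add: power2_eq_square algebra_simps)
  also have "\<dots> = 4 * (sin (t / 2))\<^sup>2"
    using cos_double_sin[of "t / 2"] by simp
  also have "\<dots> \<le> 4 * (t / 2)\<^sup>2"
    using abs_sin_x_le_abs_x[of "t / 2"] by (simp only: abs_le_square_iff mult_le_cancel_left_pos zero_less_numeral)
  also have "\<dots> = \<bar>t\<bar>\<^sup>2"
    by (simp add: power_divide)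
  finally show ?thesis
    using power2_le_imp_le abs_ge_zero by blast
qed

text \<open>Average over a window of length \<epsilon> around \<beta>: the Lipschitz bound changes
  \<phi> by at most A \<epsilon> there, and dividing the L^2 bound 4 \<epsilon>^2 by the window
  length leaves one power of \<epsilon>.\<close>

lemma Lipschitz_sup_bound:
  fixes \<phi> :: "real \<Rightarrow> complex"
  assumes lip: "\<And>\<beta> \<gamma>. cmod (\<phi> \<beta> - \<phi> \<gamma>) \<le> A * \<bar>\<beta> - \<gamma>\<bar>"
    and cont: "continuous_on {0..1} \<phi>" and \<epsilon>: "0 < \<epsilon>" "\<epsilon> \<le> 1"
    and int: "integral {0..1} (\<lambda>\<gamma>. (cmod (\<phi> \<gamma>))\<^sup>2) \<le> 4 * \<epsilon>\<^sup>2" and \<beta>: "\<beta> \<in> {0..1}" and A: "A \<ge> 0"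
  shows "(cmod (\<phi> \<beta>))\<^sup>2 \<le> (8 + 2 * A\<^sup>2) * \<epsilon>"
proof -
  \<comment> \<open>The left end of the window, moved back if necessary so that the window stays
    inside [0, 1].\<close>
  define s where "s = min \<beta> (1 - \<epsilon>)"
  have s: "0 \<le> s" "s + \<epsilon> \<le> 1" "s \<le> \<beta>" "\<beta> \<le> s + \<epsilon>"
    using \<beta> \<epsilon> by (auto simp: s_def min_def)
  have cont': "continuous_on {s..s+\<epsilon>} \<phi>"
    by (rule continuous_on_subset[OF cont]) (use s in auto)
  have "\<epsilon> * (cmod (\<phi> \<beta>))\<^sup>2 = integral {s..s+\<epsilon>} (\<lambda>_. (cmod (\<phi> \<beta>))\<^sup>2)"
    using \<epsilon> by simp
  also have "\<dots> \<le> integral {s..s+\<epsilon>} (\<lambda>\<gamma>. 2 * (cmod (\<phi> \<gamma>))\<^sup>2 + 2 * A\<^sup>2 * \<epsilon>\<^sup>2)"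
  proof (rule integral_le)
    fix \<gamma> assume \<gamma>: "\<gamma> \<in> {s..s+\<epsilon>}"
    have "cmod (\<phi> \<beta>) \<le> cmod (\<phi> \<gamma>) + cmod (\<phi> \<beta> - \<phi> \<gamma>)"
      by (metis add_diff_cancel_left' diff_add_cancel norm_triangle_ineq)
    also have "\<bar>\<beta> - \<gamma>\<bar> \<le> \<epsilon>"
      using s \<gamma> by (auto simp: abs_if)
    then have "cmod (\<phi> \<gamma>) + cmod (\<phi> \<beta> - \<phi> \<gamma>) \<le> cmod (\<phi> \<gamma>) + A * \<epsilon>"
      using lip[of \<beta> \<gamma>] mult_left_mono[of "\<bar>\<beta> - \<gamma>\<bar>" \<epsilon> A] A by linarith
    finally have "(cmod (\<phi> \<beta>))\<^sup>2 \<le> (cmod (\<phi> \<gamma>) + A * \<epsilon>)\<^sup>2"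
      by (intro power_mono) auto
    also have "\<dots> \<le> 2 * (cmod (\<phi> \<gamma>))\<^sup>2 + 2 * (A * \<epsilon>)\<^sup>2"
      using zero_le_power2[of "cmod (\<phi> \<gamma>) - A * \<epsilon>"] by (simp add: power2_eq_square algebra_simps)
    finally show "(cmod (\<phi> \<beta>))\<^sup>2 \<le> 2 * (cmod (\<phi> \<gamma>))\<^sup>2 + 2 * A\<^sup>2 * \<epsilon>\<^sup>2"
      by (simp add: power_mult_distrib)
  qed (auto intro!: integrable_continuous_real continuous_intros cont')
  also have "\<dots> = 2 * integral {s..s+\<epsilon>} (\<lambda>\<gamma>. (cmod (\<phi> \<gamma>))\<^sup>2) + 2 * A\<^sup>2 * \<epsilon>\<^sup>2 * \<epsilon>"
    using \<epsilon> by (subst integral_add) (auto intro!: integrable_continuous_real continuous_intros cont')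
  also have "integral {s..s+\<epsilon>} (\<lambda>\<gamma>. (cmod (\<phi> \<gamma>))\<^sup>2) \<le> integral {0..1} (\<lambda>\<gamma>. (cmod (\<phi> \<gamma>))\<^sup>2)"
    by (rule integral_subset_le) (use s in \<open>auto intro!: integrable_continuous_real continuous_intros cont cont'\<close>)
  also note int
  finally have "\<epsilon> * (cmod (\<phi> \<beta>))\<^sup>2 \<le> \<epsilon> * (8 * \<epsilon> + 2 * A\<^sup>2 * \<epsilon>\<^sup>2)"
    by (simp add: power2_eq_square algebra_simps)
  then have "(cmod (\<phi> \<beta>))\<^sup>2 \<le> 8 * \<epsilon> + 2 * A\<^sup>2 * \<epsilon>\<^sup>2"
    using \<epsilon> by (simp add: mult_le_cancel_left_pos)
  also have "\<epsilon>\<^sup>2 \<le> \<epsilon>"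
    using \<epsilon> by (simp add: power2_eq_square mult_left_le)
  then have "8 * \<epsilon> + 2 * A\<^sup>2 * \<epsilon>\<^sup>2 \<le> 8 * \<epsilon> + 2 * A\<^sup>2 * \<epsilon>"
    by (intro add_left_mono mult_left_mono) auto
  finally show ?thesis
    by (simp add: algebra_simps)
qed

locale interval_fourier =
  fixes w :: "real \<Rightarrow> complex"
  assumes w_cont: "continuous_on {-1..1} w"
begin

definition transform :: "real \<Rightarrow> complex" where
  "transform \<alpha> = integral {-1..1} (\<lambda>x. cis (\<alpha> * x) * w x)"

definition L1 :: real where
  "L1 = integral {-1..1} (\<lambda>x. cmod (w x))"

lemma integrable_mult_w:
  assumes "continuous_on {-1..1} q"
  shows "(\<lambda>x. q x * w x) integrable_on {-1..1}"
  by (intro integrable_continuous_real continuous_intros assms w_cont)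

lemma norm_integral_mult_w_le:
  assumes q: "continuous_on {-1..1} q" and c: "\<And>x. x \<in> {-1..1} \<Longrightarrow> cmod (q x) \<le> c"
  shows "cmod (integral {-1..1} (\<lambda>x. q x * w x)) \<le> c * L1"
proof -
  have "cmod (integral {-1..1} (\<lambda>x. q x * w x)) \<le> integral {-1..1} (\<lambda>x. c * cmod (w x))"
  proof (rule integral_norm_bound_integral)
    show "(\<lambda>x. q x * w x) integrable_on {-1..1}"
      by (rule integrable_mult_w[OF q])
    show "(\<lambda>x. c * cmod (w x)) integrable_on {-1..1}"
      by (intro integrable_continuous_real continuous_intros w_cont)
    show "cmod (q x * w x) \<le> c * cmod (w x)" if "x \<in> {-1..1}" for x
      using c[OF that] by (auto simp: norm_mult intro: mult_right_mono)
  qed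
  then show ?thesis
    by (simp add: L1_def)
qed

lemma L1_nonneg: "0 \<le> L1"
  unfolding L1_def
  by (rule Henstock_Kurzweil_Integration.integral_nonneg)
    (auto intro!: integrable_continuous_real continuous_intros w_cont)

lemma continuous_cis_mult: "continuous_on S (\<lambda>x. cis (c * x))"
  by (simp add: cis_conv_exp) (intro continuous_intros)

lemma transform_Lipschitz: "cmod (transform \<beta> - transform \<gamma>) \<le> L1 * \<bar>\<beta> - \<gamma>\<bar>"
proof -
  have "transform \<beta> - transform \<gamma> = integral {-1..1} (\<lambda>x. (cis (\<beta> * x) - cis (\<gamma> * x)) * w x)"
    unfolding transform_def
    by (simp add: left_diff_distrib Henstock_Kurzweil_Integration.integral_diff integrable_mult_w continuous_cis_mult)
  also have "cmod \<dots> \<le> \<bar>\<beta> - \<gamma>\<bar> * L1"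
  proof (rule norm_integral_mult_w_le)
    show "continuous_on {-1..1} (\<lambda>x. cis (\<beta> * x) - cis (\<gamma> * x))"
      by (intro continuous_intros continuous_cis_mult)
    fix x :: real assume x: "x \<in> {-1..1}"
    have "cis (\<beta> * x) - cis (\<gamma> * x) = cis (\<gamma> * x) * (cis ((\<beta> - \<gamma>) * x) - 1)"
      by (simp add: right_diff_distrib cis_mult algebra_simps)
    then have "cmod (cis (\<beta> * x) - cis (\<gamma> * x)) = cmod (cis ((\<beta> - \<gamma>) * x) - 1)"
      by (simp add: norm_mult)
    also have "\<dots> \<le> \<bar>(\<beta> - \<gamma>) * x\<bar>"
      by (rule norm_cis_minus_1_le)
    also have "\<dots> \<le> \<bar>\<beta> - \<gamma>\<bar>"
      using x by (simp add: abs_mult mult_left_le abs_le_iff)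
    finally show "cmod (cis (\<beta> * x) - cis (\<gamma> * x)) \<le> \<bar>\<beta> - \<gamma>\<bar>" .
  qed
  finally show ?thesis
    by (simp add: mult.commute)
qed

lemma transform_continuous: "continuous_on S transform"
proof -
  have "L1-lipschitz_on UNIV transform"
    using transform_Lipschitz L1_nonneg by (auto simp: lipschitz_on_def dist_norm dist_real_def)
  then show ?thesis
    using lipschitz_on_continuous_on continuous_on_subset by blast
qed

lemma transform_step:
  "transform (real n * \<eta>) = (\<Sum>j\<le>n. of_nat (n choose j) * integral {-1..1} (\<lambda>x. (cis (\<eta> * x) - 1) ^ j * w x))"
proof -
  have "cis (real n * \<eta> * x) * w x = (\<Sum>j\<le>n. of_nat (n choose j) * ((cis (\<eta> * x) - 1) ^ j * w x))" for x
  proof -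
    have "cis (real n * \<eta> * x) = ((cis (\<eta> * x) - 1) + 1) ^ n"
      by (simp add: Complex.DeMoivre mult.assoc)
    also have "\<dots> = (\<Sum>j\<le>n. of_nat (n choose j) * (cis (\<eta> * x) - 1) ^ j)"
      by (subst binomial_ring) simp
    finally show ?thesis
      by (simp add: sum_distrib_right mult.assoc)
  qed
  then show ?thesis
    unfolding transform_def
    by (simp add: Henstock_Kurzweil_Integration.integral_sum integrable_on_mult_right integrable_mult_w
        continuous_on_power continuous_on_diff continuous_cis_mult)
qed

text \<open>This is the j-th forward difference of the transform at 0: small of order
  \<bar>\<eta>\<bar>^j as an integral, and determined by the nodes 0, ..., j \<eta> as a
  sum.\<close>

lemma difference_eq:
  "integral {-1..1} (\<lambda>x. (cis (\<eta> * x) - 1) ^ j * w x) =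
    (\<Sum>i\<le>j. of_nat (j choose i) * (-1) ^ (j - i) * transform (real i * \<eta>))"
proof -
  have "(cis (\<eta> * x) - 1) ^ j * w x =
      (\<Sum>i\<le>j. (of_nat (j choose i) * (-1) ^ (j - i)) * (cis (real i * \<eta> * x) * w x))" for x
  proof -
    have "(cis (\<eta> * x) + (-1)) ^ j = (\<Sum>i\<le>j. of_nat (j choose i) * cis (\<eta> * x) ^ i * (-1) ^ (j - i))"
      by (rule binomial_ring)
    then show ?thesis
      by (simp add: Complex.DeMoivre sum_distrib_left mult_ac)
  qed
  then show ?thesis
    unfolding transform_def
    by (simp add: Henstock_Kurzweil_Integration.integral_sum integrable_on_mult_right integrable_mult_w continuous_cis_mult)
qed

lemma transform_extrapolation:
  fixes m :: nat
  assumes m: "m \<ge> 1" and g: "g \<ge> 0" "\<And>\<beta>. \<bar>\<beta>\<bar> \<le> 1 \<Longrightarrow> cmod (transform \<beta>) \<le> g" and \<alpha>: "\<bar>\<alpha>\<bar> \<le> real m"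
  shows "cmod (transform \<alpha>) \<le> g * 3 ^ (4 * m\<^sup>2) + L1 * exp (- real m)"
proof -
  \<comment> \<open>With n = 4 m^2 steps, \<bar>\<eta>\<bar> \<le> 1/(4 m), so the nodes up to J = 4
    m remain in [-1, 1]. The weight exp(-J) introduced below then outweighs the growth exp(3 m) of
    the full binomial sum and leaves exp(-m).\<close>
  define n where "n = 4 * m\<^sup>2"
  define J where "J = 4 * m"
  define \<eta> where "\<eta> = \<alpha> / real n"
  have n: "n > 0" using m by (simp add: n_def)
  have \<alpha>\<eta>: "\<alpha> = real n * \<eta>" using n by (simp add: \<eta>_def)
  have J\<eta>: "real J * \<bar>\<eta>\<bar> \<le> 1"
    using \<alpha> m by (simp add: \<eta>_def J_def n_def power2_eq_square field_simps)
  define D where "D j = integral {-1..1} (\<lambda>x. (cis (\<eta> * x) - 1) ^ j * w x)" for j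
  have D1: "cmod (D j) \<le> 2 ^ j * g" if "j \<le> J" for j
  proof -
    have "cmod (D j) \<le> (\<Sum>i\<le>j. cmod (of_nat (j choose i) * (-1) ^ (j - i) * transform (real i * \<eta>)))"
      unfolding D_def difference_eq by (rule norm_sum)
    also have "\<dots> \<le> (\<Sum>i\<le>j. real (j choose i) * g)"
    proof (rule sum_mono)
      fix i assume "i \<in> {..j}"
      then have "\<bar>real i * \<eta>\<bar> \<le> real J * \<bar>\<eta>\<bar>"
        using that by (auto simp: abs_mult intro!: mult_right_mono)
      then show "cmod (of_nat (j choose i) * (-1) ^ (j - i) * transform (real i * \<eta>)) \<le> real (j choose i) * g"
        using J\<eta> by (auto simp: norm_mult norm_power intro!: mult_left_mono g)
    qed
    also have "\<dots> = real (\<Sum>i\<le>j. j choose i) * g"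
      by (simp add: sum_distrib_right)
    finally show ?thesis
      by (simp add: choose_row_sum)
  qed
  have D2: "cmod (D j) \<le> \<bar>\<eta>\<bar> ^ j * L1" for j
    unfolding D_def
  proof (rule norm_integral_mult_w_le)
    show "continuous_on {-1..1} (\<lambda>x. (cis (\<eta> * x) - 1) ^ j)"
      by (intro continuous_intros continuous_cis_mult)
    fix x :: real assume x: "x \<in> {-1..1}"
    have "cmod (cis (\<eta> * x) - 1) \<le> \<bar>\<eta> * x\<bar>"
      by (rule norm_cis_minus_1_le)
    also have "\<dots> \<le> \<bar>\<eta>\<bar>"
      using x by (simp add: abs_mult mult_left_le abs_le_iff)
    finally show "cmod ((cis (\<eta> * x) - 1) ^ j) \<le> \<bar>\<eta>\<bar> ^ j"
      by (simp add: norm_power power_mono)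
  qed
  \<comment> \<open>One bound for all orders: for j > J the factor exp(j - J) \<ge> 1 is inserted
    for free. Both terms become pure powers in j, so the binomial theorem sums them in closed
    form.\<close>
  have D3: "cmod (D j) \<le> g * 2 ^ j + L1 * exp (- real J) * (exp 1 * \<bar>\<eta>\<bar>) ^ j" for j
  proof (cases "j \<le> J")
    case True
    have "0 \<le> L1 * exp (- real J) * (exp 1 * \<bar>\<eta>\<bar>) ^ j"
      using L1_nonneg by simp
    then show ?thesis
      using D1[OF True] by (simp add: mult.commute)
  next
    case False
    have "1 \<le> exp (real j - real J)"
      using False by simp
    then have "\<bar>\<eta>\<bar> ^ j * L1 * 1 \<le> \<bar>\<eta>\<bar> ^ j * L1 * exp (real j - real J)"
      using L1_nonneg by (intro mult_left_mono) auto
    also have "exp (real j - real J) = exp (- real J) * exp 1 ^ j"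
      by (simp add: exp_of_nat_mult[symmetric] exp_add[symmetric])
    also have "\<bar>\<eta>\<bar> ^ j * L1 * (exp (- real J) * exp 1 ^ j) = L1 * exp (- real J) * (exp 1 * \<bar>\<eta>\<bar>) ^ j"
      by (simp add: power_mult_distrib)
    finally show ?thesis
      using D2[of j] mult_nonneg_nonneg[OF g(1) zero_le_power[of 2 j]] by linarith
  qed
  have "cmod (transform \<alpha>) \<le> (\<Sum>j\<le>n. real (n choose j) * cmod (D j))"
    unfolding \<alpha>\<eta> transform_step D_def[symmetric]
    by (rule order_trans[OF norm_sum]) (simp add: norm_mult)
  also have "\<dots> \<le> (\<Sum>j\<le>n. real (n choose j) * (g * 2 ^ j + L1 * exp (- real J) * (exp 1 * \<bar>\<eta>\<bar>) ^ j))"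
    by (intro sum_mono mult_left_mono D3) auto
  also have "\<dots> = g * (\<Sum>j\<le>n. real (n choose j) * 2 ^ j)
      + L1 * exp (- real J) * (\<Sum>j\<le>n. real (n choose j) * (exp 1 * \<bar>\<eta>\<bar>) ^ j)"
    by (simp add: sum_distrib_left sum.distrib distrib_left mult_ac)
  also have "(\<Sum>j\<le>n. real (n choose j) * 2 ^ j) = 3 ^ n"
    using binomial_ring[of 2 "1::real" n] by simp
  also have "(\<Sum>j\<le>n. real (n choose j) * (exp 1 * \<bar>\<eta>\<bar>) ^ j) = (exp 1 * \<bar>\<eta>\<bar> + 1) ^ n"
    using binomial_ring[of "exp 1 * \<bar>\<eta>\<bar>" "1::real" n] by simp
  finally have bound: "cmod (transform \<alpha>) \<le> g * 3 ^ n + L1 * exp (- real J) * (exp 1 * \<bar>\<eta>\<bar> + 1) ^ n" .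
  have "(exp 1 * \<bar>\<eta>\<bar> + 1) ^ n \<le> exp (exp 1 * \<bar>\<eta>\<bar>) ^ n"
    using exp_ge_add_one_self[of "exp 1 * \<bar>\<eta>\<bar>"] by (intro power_mono) (auto simp: add.commute)
  also have "\<dots> = exp (exp 1 * \<bar>\<alpha>\<bar>)"
    by (simp add: exp_of_nat_mult[symmetric] \<alpha>\<eta> abs_mult mult_ac)
  \<comment> \<open>The coefficient 3 bounds Euler's number.\<close>
  also have "\<dots> \<le> exp (3 * real m)"
    using \<alpha> exp_le by (auto intro!: mult_mono)
  finally have "L1 * exp (- real J) * (exp 1 * \<bar>\<eta>\<bar> + 1) ^ n \<le> L1 * exp (- real J) * exp (3 * real m)"
    using L1_nonneg by (intro mult_left_mono) auto
  also have "\<dots> = L1 * exp (- real m)"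
    by (simp add: J_def mult.assoc exp_add[symmetric])
  finally show ?thesis
    using bound by (simp add: n_def)
qed

text \<open>The L^2 bound on both half-intervals gives the supremum bound g^2 = (8 + 2 L1^2)
  \<epsilon> on [-1, 1]. Squaring the extrapolation turns 3 into 9 and doubles both terms.\<close>

lemma transform_continuation:
  fixes m :: nat
  assumes m: "m \<ge> 1" and \<epsilon>: "0 < \<epsilon>" "\<epsilon> \<le> 1"
    and int: "integral {0..1} (\<lambda>\<beta>. (cmod (transform \<beta>))\<^sup>2 + (cmod (transform (- \<beta>)))\<^sup>2) \<le> 4 * \<epsilon>\<^sup>2"
    and \<alpha>: "\<bar>\<alpha>\<bar> \<le> real m"
  shows "(cmod (transform \<alpha>))\<^sup>2 \<le> 2 * (8 + 2 * L1\<^sup>2) * \<epsilon> * 9 ^ (4 * m\<^sup>2) + 2 * L1\<^sup>2 * exp (- 2 * real m)"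
proof -
  have c: "continuous_on {0..1} (\<lambda>\<beta>. transform (- \<beta>))"
    by (rule continuous_on_compose2[OF transform_continuous[of UNIV]]) (auto intro: continuous_intros)
  note i = integrable_continuous_real[OF continuous_on_power[OF continuous_on_norm[OF transform_continuous]]]
    integrable_continuous_real[OF continuous_on_power[OF continuous_on_norm[OF c]]]
  have "integral {0..1} (\<lambda>\<beta>. (cmod (transform \<beta>))\<^sup>2) \<le> integral {0..1} (\<lambda>\<beta>. (cmod (transform \<beta>))\<^sup>2 + (cmod (transform (- \<beta>)))\<^sup>2)"
    "integral {0..1} (\<lambda>\<beta>. (cmod (transform (- \<beta>)))\<^sup>2) \<le> integral {0..1} (\<lambda>\<beta>. (cmod (transform \<beta>))\<^sup>2 + (cmod (transform (- \<beta>)))\<^sup>2)"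
    by (intro integral_le integrable_add i; simp)+
  then have b: "(cmod (transform \<beta>))\<^sup>2 \<le> (8 + 2 * L1\<^sup>2) * \<epsilon>" "(cmod (transform (- \<beta>)))\<^sup>2 \<le> (8 + 2 * L1\<^sup>2) * \<epsilon>"
    if "\<beta> \<in> {0..1}" for \<beta>
    using int that \<epsilon> L1_nonneg transform_Lipschitz transform_Lipschitz[of "- \<beta>" "- \<gamma>" for \<beta> \<gamma>]
    by (intro Lipschitz_sup_bound transform_continuous c; simp add: abs_minus_commute)+
  define g where "g = sqrt ((8 + 2 * L1\<^sup>2) * \<epsilon>)"
  have g2: "g\<^sup>2 = (8 + 2 * L1\<^sup>2) * \<epsilon>"
    unfolding g_def using \<epsilon> by (intro real_sqrt_pow2) auto
  have "cmod (transform \<beta>) \<le> g" if "\<bar>\<beta>\<bar> \<le> 1" for \<beta>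
    unfolding g_def using b(1)[of \<beta>] b(2)[of "- \<beta>"] that
    by (intro real_le_rsqrt) (auto simp: abs_if split: if_splits)
  then have "cmod (transform \<alpha>) \<le> g * 3 ^ (4 * m\<^sup>2) + L1 * exp (- real m)"
    using \<epsilon> by (intro transform_extrapolation m \<alpha>) (auto simp: g_def)
  then have "(cmod (transform \<alpha>))\<^sup>2 \<le> (g * 3 ^ (4 * m\<^sup>2) + L1 * exp (- real m))\<^sup>2"
    by (intro power_mono) auto
  also have "\<dots> \<le> 2 * (g * 3 ^ (4 * m\<^sup>2))\<^sup>2 + 2 * (L1 * exp (- real m))\<^sup>2"
    using zero_le_power2[of "g * 3 ^ (4 * m\<^sup>2) - L1 * exp (- real m)"]
    by (simp add: power2_eq_square algebra_simps)
  also have "(g * 3 ^ (4 * m\<^sup>2))\<^sup>2 = (8 + 2 * L1\<^sup>2) * \<epsilon> * 9 ^ (4 * m\<^sup>2)"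
    by (simp only: power_mult_distrib g2 power_mult[symmetric] mult.commute[of _ 2])
      (simp add: power_mult)
  also have "(L1 * exp (- real m))\<^sup>2 = L1\<^sup>2 * exp (- 2 * real m)"
    by (simp add: power_mult_distrib exp_double[symmetric])
  finally show ?thesis by (simp only: mult.assoc)
qed

end

section \<open>The boundary value problem\<close>

lemma compact_support_representative:
  assumes f: "f \<in> sobolev_space 2 \<Omega>" and supp: "compactly_supported_in f \<Omega>"
  obtains w w' where "AE x in \<Lambda>. f x = w x" "AE x in \<Lambda>. weak_deriv \<Omega> 1 f x = w' x"
    "\<And>x. (w has_vector_derivative w' x) (at x)" "continuous_on UNIV w'"
    "\<And>x. 1 \<le> \<bar>x\<bar> \<Longrightarrow> w x = 0" "\<And>x. 1 \<le> \<bar>x\<bar> \<Longrightarrow> w' x = 0"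
proof -
  obtain v v' where v: "continuous_on {-1..1} v'" "AE x in \<Lambda>. f x = v x" "AE x in \<Lambda>. weak_deriv \<Omega> 1 f x = v' x"
    "\<And>x. x \<in> {-1..1} \<Longrightarrow> (v has_vector_derivative v' x) (at x within {-1..1})"
    by (rule sobolev_2_C1[OF f]) blast
  have v_cont: "continuous_on {-1..1} v"
    using v(4) by (rule has_vector_derivative_continuous_on)
  obtain A where A: "compact A" "A \<subseteq> \<Omega>" "AE x in \<Lambda>. x \<notin> A \<longrightarrow> f x = 0"
    using supp by (auto simp: compactly_supported_in_def)
  obtain r where r: "0 \<le> r" "r < 1" "\<And>x. x \<in> A \<Longrightarrow> \<bar>x\<bar> \<le> r"
  proof (cases "A = {}")
    case True
    then show ?thesis using that[of 0] by auto
  next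
    case False
    then obtain y where y: "y \<in> A" "\<And>x. x \<in> A \<Longrightarrow> \<bar>x\<bar> \<le> \<bar>y\<bar>"
      using continuous_attains_sup[of A abs] A(1) continuous_on_rabs[OF continuous_on_id] by blast
    have "y \<in> \<Omega>" using y(1) A(2) by blast
    then show ?thesis
      using y(2) by (intro that[of "\<bar>y\<bar>"]) (auto simp: abs_less_iff)
  qed
  \<comment> \<open>The factor is continuous and positive exactly for \<bar>x\<bar> > r. It turns
    vanishing off A into an almost everywhere statement on all of \<Omega>, which continuity
    upgrades to every point.\<close>
  have ae: "AE x in \<Lambda>. v x * of_real (max 0 (\<bar>x\<bar> - r)) = 0"
    using A(3) v(2)
  proof eventually_elim
    case (elim x)
    then show ?case using r(3)[of x] by (cases "x \<in> A") auto
  qed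
  have "v x * of_real (max 0 (\<bar>x\<bar> - r)) = 0" if "x \<in> {-1..1}" for x
    by (rule continuous_AE_eq[of "\<lambda>x. v x * of_real (max 0 (\<bar>x\<bar> - r))" "\<lambda>_. 0", OF _ continuous_on_const ae that])
      (intro continuous_intros v_cont)
  then have v0: "v x = 0" if "x \<in> {-1..1}" "r < \<bar>x\<bar>" for x
    using that by fastforce
  have v'0: "v' x = 0" if x: "x \<in> {-1..1}" "r < \<bar>x\<bar>" for x
  proof -
    have "(v has_vector_derivative 0) (at x within {-1..1})"
    proof (rule has_vector_derivative_transform_within[where d = "\<bar>x\<bar> - r" and f = "\<lambda>_. 0"])
      show "0 = v y" if "y \<in> {-1..1}" "dist y x < \<bar>x\<bar> - r" for y
        using that by (intro v0[symmetric]) (auto simp: dist_real_def)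
    qed (use x in auto)
    then show ?thesis
      using vector_derivative_unique_within_closed_interval[of "-1" 1 x v "v' x" 0] v(4) x by simp
  qed
  \<comment> \<open>Clamping to [-1, 1]: since v and v' vanish beyond r, composing with c extends
    them by zero, and continuity is inherited from the composition.\<close>
  define c where "c x = max (-1) (min 1 x)" for x :: real
  have c: "c x \<in> {-1..1}" for x
    by (auto simp: c_def)
  have c_id: "c x = x" if "x \<in> {-1..1}" for x
    using that by (auto simp: c_def)
  have c_out: "\<bar>c x\<bar> = 1" if "1 \<le> \<bar>x\<bar>" for x
    using that by (auto simp: c_def)
  define w where "w x = v (c x)" for x
  define w' where "w' x = v' (c x)" for x
  have out: "w x = 0" "w' x = 0" if "r < \<bar>x\<bar>" for x
  proof -
    have "r < \<bar>c x\<bar>"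
      using that r(2) by (auto simp: c_def max_def min_def abs_if split: if_splits)
    then show "w x = 0" "w' x = 0"
      by (auto simp: w_def w'_def intro: v0 v'0 c)
  qed
  have in\<Omega>: "AE x in \<Lambda>. x \<in> {-1..1}"
    by (intro AE_I2) auto
  show ?thesis
  proof (rule that[of w w'])
    show "AE x in \<Lambda>. f x = w x"
      using v(2) in\<Omega> by eventually_elim (simp add: w_def c_id)
    show "AE x in \<Lambda>. weak_deriv \<Omega> 1 f x = w' x"
      using v(3) in\<Omega> by eventually_elim (simp add: w'_def c_id)
    show "(w has_vector_derivative w' x) (at x)" for x
    proof (cases "\<bar>x\<bar> < 1")
      case True
      then have "(v has_vector_derivative v' x) (at x within {-1<..<1})"
        by (intro has_vector_derivative_within_subset[OF v(4)]) auto
      moreover have "at x within {-1<..<1} = at x"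
        using True by (intro at_within_open) auto
      ultimately have "(v has_vector_derivative w' x) (at x)"
        using True c_id[of x] by (simp add: w'_def abs_less_iff)
      then show ?thesis
        by (rule has_vector_derivative_transform_within_open[where S = "{-1<..<1}"])
          (use True in \<open>auto simp: w_def c_id\<close>)
    next
      case False
      then have "r < \<bar>x\<bar>" using r by simp
      have "((\<lambda>_. 0) has_vector_derivative w' x) (at x)"
        using out(2)[OF \<open>r < \<bar>x\<bar>\<close>] by simp
      then show ?thesis
      proof (rule has_vector_derivative_transform_within_open[where S = "{y. r < \<bar>y\<bar>}"])
        show "open {y::real. r < \<bar>y\<bar>}"
          by (intro open_Collect_less continuous_intros)
      qed (use \<open>r < \<bar>x\<bar>\<close> out(1) in auto)
    qed
    show "continuous_on UNIV w'"
      unfolding w'_def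
      by (rule continuous_on_compose2[OF v(1)]) (auto intro: c simp: c_def intro!: continuous_intros)
    show "w x = 0" "w' x = 0" if "1 \<le> \<bar>x\<bar>" for x
      using out[of x] that r(2) by auto
  qed
qed

text \<open>The product (v' - i \<beta> v) e^(i \<beta> x) is an explicit antiderivative of (v'' +
  \<beta>^2 v) e^(i \<beta> x), which is w e^(i \<beta> x) for either sign \<beta> = \<alpha> or
  \<beta> = -\<alpha>.\<close>

lemma helmholtz_transform:
  fixes w v v' :: "real \<Rightarrow> complex"
  assumes \<beta>: "\<beta>\<^sup>2 = \<alpha>\<^sup>2"
    and v: "\<And>x. x \<in> {-1..1} \<Longrightarrow> (v has_vector_derivative v' x) (at x within {-1..1})"
    and v': "\<And>x. x \<in> {-1..1} \<Longrightarrow> (v' has_vector_derivative w x - of_real (\<alpha>\<^sup>2) * v x) (at x within {-1..1})"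
    and w: "continuous_on {-1..1} w"
  shows "interval_fourier.transform w \<beta> =
    (v' 1 - \<i> * of_real \<beta> * v 1) * cis \<beta> - (v' (-1) - \<i> * of_real \<beta> * v (-1)) * cis (- \<beta>)"
proof -
  interpret interval_fourier w by standard (rule w)
  define e where "e x = cis (\<beta> * x)" for x
  have e: "(e has_vector_derivative \<i> * of_real \<beta> * e x) (at x within S)" for x S
    unfolding e_def cis_conv_exp
    by (auto intro!: derivative_eq_intros has_vector_derivative_real_field simp: mult_ac)
  have "((\<lambda>x. (v' x - \<i> * of_real \<beta> * v x) * e x) has_vector_derivative e x * w x) (at x within {-1..1})"
    if x: "x \<in> {-1..1}" for x
  proof -
    have "((\<lambda>x. (v' x - \<i> * of_real \<beta> * v x) * e x) has_vector_derivative
        (v' x - \<i> * of_real \<beta> * v x) * (\<i> * of_real \<beta> * e x)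
        + ((w x - of_real (\<alpha>\<^sup>2) * v x) - \<i> * of_real \<beta> * v' x) * e x) (at x within {-1..1})"
      by (intro has_vector_derivative_mult has_vector_derivative_diff has_vector_derivative_mult_right v[OF x] v'[OF x] e)
    moreover have "(v' x - \<i> * of_real \<beta> * v x) * (\<i> * of_real \<beta> * e x)
        + ((w x - of_real (\<alpha>\<^sup>2) * v x) - \<i> * of_real \<beta> * v' x) * e x
      = e x * w x + (of_real (\<beta>\<^sup>2) - of_real (\<alpha>\<^sup>2)) * v x * e x"
      by (simp add: power2_eq_square algebra_simps)
    ultimately show ?thesis
      using \<beta> by simp
  qed
  from fundamental_theorem_of_calculus[OF _ this]
  have "((\<lambda>x. e x * w x) has_integral (v' 1 - \<i> * of_real \<beta> * v 1) * e 1 - (v' (-1) - \<i> * of_real \<beta> * v (-1)) * e (-1)) {-1..1}"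
    by simp
  then show ?thesis
    unfolding transform_def by (simp add: e_def integral_unique)
qed

text \<open>The boundary conditions annihilate the term at one endpoint and double it at the other:
  \<beta> = \<alpha> keeps the endpoint 1, \<beta> = -\<alpha> keeps -1.\<close>

lemma helmholtz_boundary_values:
  assumes \<alpha>: "\<alpha> > 0" and u: "helmholtz_solution \<alpha> f u"
    and w: "continuous_on {-1..1} w" "AE x in \<Lambda>. f x = w x"
  shows "cmod (interval_fourier.transform w \<alpha>) = 2 * \<alpha> * cmod (trace_at \<Omega> u 1)"
    "cmod (interval_fourier.transform w (-\<alpha>)) = 2 * \<alpha> * cmod (trace_at \<Omega> u (-1))"
proof -
  have uS: "u \<in> sobolev_space 2 \<Omega>"
    and eq: "AE x in \<Lambda>. weak_deriv \<Omega> 2 u x + (of_real \<alpha>)\<^sup>2 * u x = f x"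
    and bc1: "trace_at \<Omega> (weak_deriv \<Omega> 1 u) 1 + \<i> * of_real \<alpha> * trace_at \<Omega> u 1 = 0"
    and bc2: "trace_at \<Omega> (weak_deriv \<Omega> 1 u) (-1) - \<i> * of_real \<alpha> * trace_at \<Omega> u (-1) = 0"
    using u by (auto simp: helmholtz_solution_def)
  obtain v0 v0' where v0: "AE x in \<Lambda>. u x = v0 x"
    "\<And>x. x \<in> {-1..1} \<Longrightarrow> (v0 has_vector_derivative v0' x) (at x within {-1..1})"
    using sobolev_2_C1[OF uS] by metis
  have v0c: "continuous_on {-1..1} v0"
    using v0(2) by (rule has_vector_derivative_continuous_on)
  \<comment> \<open>A continuous representative \<open>v0\<close> of u, put into the equation,
    yields a continuous second derivative. The classical solution \<open>v\<close> obtained from it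
    is then identified with \<open>v0\<close>.\<close>
  have c: "continuous_on {-1..1} (\<lambda>x. w x - of_real (\<alpha>\<^sup>2) * v0 x)"
    by (intro continuous_intros w v0c)
  have "AE x in \<Lambda>. weak_deriv \<Omega> 2 u x = w x - of_real (\<alpha>\<^sup>2) * v0 x"
    using eq w(2) v0(1) by eventually_elim (simp add: algebra_simps)
  then obtain v v' where v: "AE x in \<Lambda>. u x = v x" "AE x in \<Lambda>. weak_deriv \<Omega> 1 u x = v' x"
    "\<And>x. x \<in> {-1..1} \<Longrightarrow> (v has_vector_derivative v' x) (at x within {-1..1})"
    "\<And>x. x \<in> {-1..1} \<Longrightarrow> (v' has_vector_derivative w x - of_real (\<alpha>\<^sup>2) * v0 x) (at x within {-1..1})"
    by (rule sobolev_2_C2[OF uS c]) blast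
  note vc = has_vector_derivative_continuous_on[OF v(3)] has_vector_derivative_continuous_on[OF v(4)]
  have "AE x in \<Lambda>. v0 x = v x"
    using v0(1) v(1) by eventually_elim simp
  then have "v0 x = v x" if "x \<in> {-1..1}" for x
    using continuous_AE_eq[OF v0c vc(1) _ that] by blast
  with v(4) have v4: "\<And>x. x \<in> {-1..1} \<Longrightarrow> (v' has_vector_derivative w x - of_real (\<alpha>\<^sup>2) * v x) (at x within {-1..1})"
    by simp
  have tr: "trace_at \<Omega> u x = v x" "trace_at \<Omega> (weak_deriv \<Omega> 1 u) x = v' x" if "x \<in> {-1..1}" for x
    using trace_at_eqI[OF vc(1) v(1) that] trace_at_eqI[OF vc(2) v(2) that] by auto
  have b: "v' 1 = - \<i> * of_real \<alpha> * v 1" "v' (-1) = \<i> * of_real \<alpha> * v (-1)"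
    using bc1 bc2 by (simp_all add: tr add_eq_0_iff del: One_nat_def)
  have "interval_fourier.transform w \<alpha> = - 2 * \<i> * of_real \<alpha> * v 1 * cis \<alpha>"
    by (subst helmholtz_transform[OF refl v(3) v4 w(1)]) (auto simp: b algebra_simps)
  then show "cmod (interval_fourier.transform w \<alpha>) = 2 * \<alpha> * cmod (trace_at \<Omega> u 1)"
    using \<alpha> by (simp add: tr norm_mult)
  have "interval_fourier.transform w (-\<alpha>) = - 2 * \<i> * of_real \<alpha> * v (-1) * cis \<alpha>"
    by (subst helmholtz_transform[OF power2_minus v(3) v4 w(1)]) (auto simp: b algebra_simps)
  then show "cmod (interval_fourier.transform w (-\<alpha>)) = 2 * \<alpha> * cmod (trace_at \<Omega> u (-1))"
    using \<alpha> by (simp add: tr norm_mult)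
qed

lemma boundary_data_eq:
  assumes u: "\<And>\<alpha>. \<alpha> > 0 \<Longrightarrow> helmholtz_solution \<alpha> f (u \<alpha>)"
    and w: "continuous_on {-1..1} w" "AE x in \<Lambda>. f x = w x" and K: "K \<ge> 0"
  defines "G \<equiv> \<lambda>\<alpha>. (cmod (interval_fourier.transform w \<alpha>))\<^sup>2 + (cmod (interval_fourier.transform w (- \<alpha>)))\<^sup>2"
  shows "integral {0..K} G = 4 * (boundary_data u K)\<^sup>2" "0 \<le> boundary_data u K" "continuous_on UNIV G"
proof -
  interpret interval_fourier w by standard (rule w)
  have "continuous_on UNIV (\<lambda>\<alpha>. transform (- \<alpha>))"
    by (rule continuous_on_compose2[OF transform_continuous[of UNIV]]) (auto intro: continuous_intros)
  then show Gc: "continuous_on UNIV G"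
    unfolding G_def by (intro continuous_intros transform_continuous)
  define h where "h \<alpha> = \<alpha>\<^sup>2 * ((cmod (trace_at \<Omega> (u \<alpha>) 1))\<^sup>2 + (cmod (trace_at \<Omega> (u \<alpha>) (-1)))\<^sup>2)" for \<alpha>
  have hG: "h \<alpha> = G \<alpha> / 4" if "\<alpha> > 0" for \<alpha>
    using helmholtz_boundary_values[OF that u[OF that] w]
    by (simp add: h_def G_def power_mult_distrib distrib_left)
  \<comment> \<open>No solution is assumed at \<alpha> = 0. There the factor \<alpha>^2 makes the
    integrand 0, which matches the half-open interval on the right.\<close>
  have eq: "(\<lambda>\<alpha>. indicator {0..K} \<alpha> *\<^sub>R h \<alpha>) = (\<lambda>\<alpha>. indicator {0<..K} \<alpha> *\<^sub>R (G \<alpha> / 4))"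
  proof
    fix \<alpha> show "indicator {0..K} \<alpha> *\<^sub>R h \<alpha> = indicator {0<..K} \<alpha> *\<^sub>R (G \<alpha> / 4)"
      using hG[of \<alpha>] by (cases "\<alpha> = 0") (auto simp: h_def indicator_def)
  qed
  have cont: "continuous_on {0..K} (\<lambda>\<alpha>. G \<alpha> / 4)"
    using Gc by (intro continuous_intros) (auto intro: continuous_on_subset)
  have "set_integrable lborel {0..K} (\<lambda>\<alpha>. G \<alpha> / 4)"
    by (rule borel_integrable_atLeastAtMost'[OF cont])
  then have si: "set_integrable lebesgue {0..K} (\<lambda>\<alpha>. G \<alpha> / 4)"
    by (simp add: set_integrable_def integrable_completion)
  then have si': "set_integrable lebesgue {0<..K} (\<lambda>\<alpha>. G \<alpha> / 4)"
    by (rule set_integrable_subset) auto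
  have "(LINT \<alpha>:{0..K}|lebesgue. h \<alpha>) = (LINT \<alpha>:{0<..K}|lebesgue. G \<alpha> / 4)"
    by (simp only: set_lebesgue_integral_def eq)
  also have "\<dots> = integral {0<..K} (\<lambda>\<alpha>. G \<alpha> / 4)"
    by (rule set_lebesgue_integral_eq_integral(2)[OF si'])
  also have "\<dots> = integral {0..K} (\<lambda>\<alpha>. G \<alpha> / 4)"
  proof (rule integral_spike_set)
    have "{x \<in> {0<..K} - {0..K}. G x / 4 \<noteq> 0} \<subseteq> {0}" "{x \<in> {0..K} - {0<..K}. G x / 4 \<noteq> 0} \<subseteq> {0}"
      by auto
    then show "negligible {x \<in> {0<..K} - {0..K}. G x / 4 \<noteq> 0}" "negligible {x \<in> {0..K} - {0<..K}. G x / 4 \<noteq> 0}"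
      using negligible_subset[OF negligible_sing] by blast+
  qed
  also have "\<dots> = integral {0..K} G / 4"
    by simp
  finally have bd: "boundary_data u K = sqrt (integral {0..K} G / 4)"
    by (simp add: boundary_data_def h_def)
  have "0 \<le> integral {0..K} G"
  proof (rule Henstock_Kurzweil_Integration.integral_nonneg)
    show "G integrable_on {0..K}"
      using Gc by (intro integrable_continuous_real) (auto intro: continuous_on_subset)
  qed (simp add: G_def)
  then show "integral {0..K} G = 4 * (boundary_data u K)\<^sup>2" "0 \<le> boundary_data u K"
    by (simp_all add: bd)
qed

section \<open>Norms and the Fejer inequality for the complex source\<close>

lemma integral_cmod_square_AE:
  fixes g w :: "real \<Rightarrow> complex"
  assumes g: "square_integrable_on g \<Omega>" and w: "continuous_on {-1..1} w" and ae: "AE x in \<Lambda>. g x = w x"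
  shows "(LINT x|\<Lambda>. (cmod (g x))\<^sup>2) = integral {-1..1} (\<lambda>x. (cmod (w x))\<^sup>2)"
proof -
  have i: "integrable \<Lambda> (\<lambda>x. (cmod (w x))\<^sup>2)"
    by (intro integrable_Omega_continuous continuous_intros w)
  have "(LINT x|\<Lambda>. (cmod (g x))\<^sup>2) = (LINT x|\<Lambda>. (cmod (w x))\<^sup>2)"
  proof (rule integral_cong_AE)
    show "AE x in \<Lambda>. (cmod (g x))\<^sup>2 = (cmod (w x))\<^sup>2"
      using ae by eventually_elim simp
  qed (use g i in \<open>auto simp: square_integrable_on_def\<close>)
  then show ?thesis
    using integral_Omega_eq(1)[OF i] by simp
qed

lemma sobolev_norm_0_1:
  assumes f: "f \<in> sobolev_space 2 \<Omega>"
    and w: "continuous_on {-1..1} w" "AE x in \<Lambda>. f x = w x"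
    and w': "continuous_on {-1..1} w'" "AE x in \<Lambda>. weak_deriv \<Omega> 1 f x = w' x"
  defines "N \<equiv> integral {-1..1} (\<lambda>x. (cmod (w x))\<^sup>2)" and "B \<equiv> integral {-1..1} (\<lambda>x. (cmod (w' x))\<^sup>2)"
  shows "(sobolev_norm 0 \<Omega> f)\<^sup>2 = N" "(sobolev_norm 1 \<Omega> f)\<^sup>2 = N + B"
proof -
  have nn: "N \<ge> 0" "B \<ge> 0"
    unfolding N_def B_def
    by (rule Henstock_Kurzweil_Integration.integral_nonneg;
      auto intro!: integrable_continuous_real continuous_intros w w')+
  have ae0: "AE x in \<Lambda>. weak_deriv \<Omega> 0 f x = w x"
    using weak_deriv_0_AE[OF f] w(2) by eventually_elim simp
  have 0: "(LINT x|\<Lambda>. (cmod (weak_deriv \<Omega> 0 f x))\<^sup>2) = N"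
    unfolding N_def by (rule integral_cmod_square_AE[OF sobolev_weak_deriv(1)[OF f] w(1) ae0]) simp
  have 1: "(LINT x|\<Lambda>. (cmod (weak_deriv \<Omega> 1 f x))\<^sup>2) = B"
    unfolding B_def by (rule integral_cmod_square_AE[OF sobolev_weak_deriv(1)[OF f] w'(1) w'(2)]) simp
  show "(sobolev_norm 0 \<Omega> f)\<^sup>2 = N"
    using nn 0 by (simp add: sobolev_norm_def)
  have "{..1::nat} = {0, 1}" by auto
  then show "(sobolev_norm 1 \<Omega> f)\<^sup>2 = N + B"
    using nn 0 1 by (simp add: sobolev_norm_def)
qed

text \<open>Cosine transforms are even and sine transforms odd in \<alpha>, so adding the energies
  at \<alpha> and -\<alpha> cancels all cross terms between real and imaginary part, and the real
  inequality applies to each part.\<close>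

lemma complex_fejer_inequality:
  fixes w w' :: "real \<Rightarrow> complex"
  assumes w: "\<And>x. (w has_vector_derivative w' x) (at x)" and w': "continuous_on UNIV w'"
    and w0: "\<And>x. 1 \<le> \<bar>x\<bar> \<Longrightarrow> w x = 0" and w'0: "\<And>x. 1 \<le> \<bar>x\<bar> \<Longrightarrow> w' x = 0" and k: "k > 0"
  defines "N \<equiv> integral {-1..1} (\<lambda>x. (cmod (w x))\<^sup>2)" and "B \<equiv> integral {-1..1} (\<lambda>x. (cmod (w' x))\<^sup>2)"
  defines "G \<equiv> \<lambda>\<alpha>. (cmod (interval_fourier.transform w \<alpha>))\<^sup>2 + (cmod (interval_fourier.transform w (- \<alpha>)))\<^sup>2"
  shows "N \<le> 2 * integral {0..k} G + 128 * (N + B) / k\<^sup>2"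
proof -
  have wc: "continuous_on S w" for S
    using has_vector_derivative_at_within[OF w] by (rule has_vector_derivative_continuous_on)
  have w'c: "continuous_on S w'" for S
    using w' continuous_on_subset by blast
  interpret W: interval_fourier w by standard (rule wc)
  interpret p: compact_C1 "\<lambda>x. Re (w x)" "\<lambda>x. Re (w' x)"
    using w w' w0 w'0
    by unfold_locales (auto intro!: continuous_intros simp: has_real_derivative_iff_has_vector_derivative
        has_vector_derivative_complex_iff)
  interpret q: compact_C1 "\<lambda>x. Im (w x)" "\<lambda>x. Im (w' x)"
    using w w' w0 w'0
    by unfold_locales (auto intro!: continuous_intros simp: has_real_derivative_iff_has_vector_derivative
        has_vector_derivative_complex_iff)
  have tr: "W.transform \<alpha> = Complex (p.cos_transform \<alpha> - q.sin_transform \<alpha>) (p.sin_transform \<alpha> + q.cos_transform \<alpha>)" for \<alpha>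
  proof -
    have i: "(\<lambda>x. cis (\<alpha> * x) * w x) integrable_on {-1..1}"
      by (rule W.integrable_mult_w[OF W.continuous_cis_mult])
    have ii: "(\<lambda>x. Re (w x) * cos (\<alpha> * x)) integrable_on {-1..1}" "(\<lambda>x. Re (w x) * sin (\<alpha> * x)) integrable_on {-1..1}"
      "(\<lambda>x. Im (w x) * cos (\<alpha> * x)) integrable_on {-1..1}" "(\<lambda>x. Im (w x) * sin (\<alpha> * x)) integrable_on {-1..1}"
      by (intro integrable_continuous_real continuous_intros wc)+
    have "Re (W.transform \<alpha>) = integral {-1..1} (\<lambda>x. Re (cis (\<alpha> * x) * w x))"
      "Im (W.transform \<alpha>) = integral {-1..1} (\<lambda>x. Im (cis (\<alpha> * x) * w x))"
      unfolding W.transform_def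
      using integral_linear[OF i bounded_linear_Re] integral_linear[OF i bounded_linear_Im] by (simp_all add: o_def)
    moreover have "(\<lambda>x. Re (cis (\<alpha> * x) * w x)) = (\<lambda>x. Re (w x) * cos (\<alpha> * x) - Im (w x) * sin (\<alpha> * x))"
      "(\<lambda>x. Im (cis (\<alpha> * x) * w x)) = (\<lambda>x. Re (w x) * sin (\<alpha> * x) + Im (w x) * cos (\<alpha> * x))"
      by (auto simp: mult_ac)
    ultimately show ?thesis
      using ii by (simp add: complex_eq_iff p.cos_transform_def q.cos_transform_def p.sin_transform_def q.sin_transform_def
         Henstock_Kurzweil_Integration.integral_diff Henstock_Kurzweil_Integration.integral_add)
  qed
  have neg: "p.cos_transform (-\<alpha>) = p.cos_transform \<alpha>" "p.sin_transform (-\<alpha>) = - p.sin_transform \<alpha>"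
    "q.cos_transform (-\<alpha>) = q.cos_transform \<alpha>" "q.sin_transform (-\<alpha>) = - q.sin_transform \<alpha>" for \<alpha>
    by (simp_all add: p.cos_transform_def q.cos_transform_def p.sin_transform_def q.sin_transform_def)
  have G: "G = (\<lambda>\<alpha>. 2 * ((p.cos_transform \<alpha>)\<^sup>2 + (p.sin_transform \<alpha>)\<^sup>2) + 2 * ((q.cos_transform \<alpha>)\<^sup>2 + (q.sin_transform \<alpha>)\<^sup>2))"
    unfolding G_def tr neg cmod_power2 complex.sel by (auto simp: power2_eq_square algebra_simps)
  have IG: "integral {0..k} G = integral {0..k} (\<lambda>\<alpha>. 2 * ((p.cos_transform \<alpha>)\<^sup>2 + (p.sin_transform \<alpha>)\<^sup>2))
      + integral {0..k} (\<lambda>\<alpha>. 2 * ((q.cos_transform \<alpha>)\<^sup>2 + (q.sin_transform \<alpha>)\<^sup>2))"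
    unfolding G
    by (intro Henstock_Kurzweil_Integration.integral_add integrable_continuous_real continuous_intros
        p.cos_sin_transform_continuous q.cos_sin_transform_continuous)
  have split: "integral {-1..1} (\<lambda>x. (cmod (v x))\<^sup>2) = integral {-1..1} (\<lambda>x. (Re (v x))\<^sup>2) + integral {-1..1} (\<lambda>x. (Im (v x))\<^sup>2)"
    if "continuous_on {-1..1} v" for v :: "real \<Rightarrow> complex"
    unfolding cmod_power2
    by (intro Henstock_Kurzweil_Integration.integral_add integrable_continuous_real continuous_intros that)
  show ?thesis
    using p.fejer_inequality[OF k] q.fejer_inequality[OF k]
    unfolding N_def B_def IG split[OF wc] split[OF w'c]
    by (simp add: add_divide_distrib distrib_left)
qed

text \<open>Cauchy-Schwarz on an interval of length 2, by expanding the squared deviation of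
  \<bar>w\<bar> from its mean L1/2.\<close>

lemma L1_square_le:
  fixes w :: "real \<Rightarrow> complex"
  assumes w: "continuous_on {-1..1} w"
  shows "(interval_fourier.L1 w)\<^sup>2 \<le> 2 * integral {-1..1} (\<lambda>x. (cmod (w x))\<^sup>2)"
proof -
  interpret interval_fourier w by standard (rule w)
  have i: "(\<lambda>x. cmod (w x)) integrable_on {-1..1}" "(\<lambda>x. (cmod (w x))\<^sup>2) integrable_on {-1..1}"
    by (intro integrable_continuous_real continuous_intros w)+
  have "0 \<le> integral {-1..1} (\<lambda>x. (cmod (w x) - L1 / 2)\<^sup>2)"
    by (rule Henstock_Kurzweil_Integration.integral_nonneg)
      (auto intro!: integrable_continuous_real continuous_intros w)
  also have "(\<lambda>x. (cmod (w x) - L1 / 2)\<^sup>2) = (\<lambda>x. (cmod (w x))\<^sup>2 + (- L1) * cmod (w x) + L1\<^sup>2 / 4)"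
    by (auto simp: power2_eq_square algebra_simps)
  also have "integral {-1..1} \<dots> = integral {-1..1} (\<lambda>x. (cmod (w x))\<^sup>2) + (- L1) * L1 + 2 * (L1\<^sup>2 / 4)"
  proof (rule integral_unique)
    have "((\<lambda>x. cmod (w x)) has_integral L1) {-1..1}"
      unfolding L1_def using i(1) by (rule integrable_integral)
    moreover have "((\<lambda>x. L1\<^sup>2 / 4) has_integral 2 * (L1\<^sup>2 / 4)) {-1..1::real}"
      using has_integral_const_real[of "L1\<^sup>2 / 4" "-1" 1] by simp
    ultimately show "((\<lambda>x. (cmod (w x))\<^sup>2 + (- L1) * cmod (w x) + L1\<^sup>2 / 4) has_integral
        integral {-1..1} (\<lambda>x. (cmod (w x))\<^sup>2) + (- L1) * L1 + 2 * (L1\<^sup>2 / 4)) {-1..1}"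
      by (intro has_integral_add has_integral_mult_right integrable_integral i)
  qed
  finally show ?thesis
    by (simp add: power2_eq_square)
qed

section \<open>The stability estimate\<close>

lemma cube_le_exp: "0 \<le> k \<Longrightarrow> k ^ 3 \<le> 6 * exp k" for k :: real
proof -
  assume k: "0 \<le> k"
  have "(\<Sum>i<4. k ^ i / fact i) \<le> exp k"
    using sum_le_suminf[OF summable_exp[of k], of "{..<4}"] k
    by (auto simp: exp_def divide_inverse mult.commute)
  moreover have "(\<Sum>i<4. k ^ i / fact i) = 1 + k + k\<^sup>2 / 2 + k ^ 3 / 6"
    by (simp add: eval_nat_numeral)
  ultimately show ?thesis
    using k zero_le_power2[of k] by linarith
qed

text \<open>From 9 \<le> e^4 and m \<le> 2 k the amplification is at most exp(64 k^2). Together with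
  k^3 \<le> 6 exp(k^2) this leaves 6 exp(65 k^2 - k^4), and completing the square bounds the
  exponent.\<close>

lemma continuation_decay:
  fixes k :: real and m :: nat
  assumes k: "k \<ge> 1" and m: "real m \<le> 2 * k" and \<epsilon>: "0 \<le> \<epsilon>" "\<epsilon> \<le> exp (- (k ^ 4))"
  shows "k ^ 3 * (\<epsilon> * 9 ^ (4 * m\<^sup>2)) \<le> 6 * exp 1057"
proof -
  have "(9::real) \<le> exp 4"
  proof -
    have "(2::real) ^ 4 \<le> exp 1 ^ 4"
      using exp_ge_add_one_self[of 1] by (intro power_mono) auto
    then show ?thesis by (simp add: exp_of_nat_mult[symmetric])
  qed
  then have "(9::real) ^ (4 * m\<^sup>2) \<le> exp 4 ^ (4 * m\<^sup>2)"
    by (intro power_mono) auto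
  also have "\<dots> = exp (16 * (real m)\<^sup>2)"
    by (simp add: exp_of_nat_mult[symmetric])
  also have "\<dots> \<le> exp (16 * (2 * k)\<^sup>2)"
    using power_mono[OF m, of 2] by simp
  finally have e9: "\<epsilon> * 9 ^ (4 * m\<^sup>2) \<le> exp (- (k ^ 4)) * exp (64 * k\<^sup>2)"
    using \<epsilon> by (intro mult_mono) (auto simp: power_mult_distrib)
  have k3: "k ^ 3 \<le> 6 * exp (k\<^sup>2)"
  proof -
    have "k \<le> k\<^sup>2"
      using k by (simp add: power2_eq_square)
    then show ?thesis
      using cube_le_exp[of k] k by (meson dual_order.trans exp_le_cancel_iff mult_left_mono zero_le_one zero_le_numeral)
  qed
  have "k ^ 3 * (\<epsilon> * 9 ^ (4 * m\<^sup>2)) \<le> (6 * exp (k\<^sup>2)) * (exp (- (k ^ 4)) * exp (64 * k\<^sup>2))"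
    by (rule mult_mono[OF k3 e9]) (use k \<epsilon> in auto)
  also have "\<dots> = 6 * exp (65 * k\<^sup>2 - k ^ 4)"
    by (simp add: exp_add[symmetric] exp_diff[symmetric])
  also have "65 * k\<^sup>2 - k ^ 4 \<le> 1057"
  proof -
    have "k ^ 4 = k\<^sup>2 * k\<^sup>2" by (simp add: eval_nat_numeral)
    then show ?thesis
      using zero_le_power2[of "k\<^sup>2 - 65 / 2"] by (simp add: power2_diff field_simps) 
  qed
  finally show ?thesis by simp
qed

text \<open>With t = K^(1/3) and s = E^(1/4) the condition t^6 = K^2 < a = t^2 s reads t^4 < s. As t
  > 1, also s > 1, so a^2 = t^4 s^2 \<le> s^4 = E.\<close>

lemma neg_ln_large:
  fixes K \<epsilon> a :: real
  assumes K: "K > 1" and \<epsilon>: "0 < \<epsilon>" "\<epsilon> < 1"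
    and a: "a = K powr (2/3) * (- ln \<epsilon>) powr (1/4)" "K\<^sup>2 < a"
  shows "\<epsilon> \<le> exp (- (a\<^sup>2))"
proof -
  define t where "t = K powr (1/3)"
  define s where "s = (- ln \<epsilon>) powr (1/4)"
  have E: "- ln \<epsilon> > 0" using \<epsilon> by simp
  have t: "t > 1" unfolding t_def using K by simp
  have s: "s > 0" unfolding s_def using E by simp
  have s4: "s ^ 4 = - ln \<epsilon>"
    unfolding s_def using E by (simp add: powr_realpow[symmetric] powr_powr)
  have t3: "t ^ 3 = K" "t ^ 2 = K powr (2/3)"
    unfolding t_def using K by (simp_all add: powr_realpow[symmetric] powr_powr)
  have a': "a = t ^ 2 * s"
    using a(1) by (simp add: t3 s_def)
  have "t ^ 2 * t ^ 4 < t ^ 2 * s"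
    using a(2) unfolding a' t3(1)[symmetric] by (simp add: power_mult[symmetric] power_add[symmetric])
  then have ts: "t ^ 4 < s"
    by (rule mult_left_less_imp_less) simp
  have "1 \<le> t ^ 4" using t by (simp add: one_le_power)
  then have "s \<le> s\<^sup>2"
    using ts by (simp add: power2_eq_square)
  then have "t ^ 4 \<le> s\<^sup>2" using ts by linarith
  then have "t ^ 4 * s\<^sup>2 \<le> s\<^sup>2 * s\<^sup>2"
    by (intro mult_right_mono) auto
  then have "a\<^sup>2 \<le> - ln \<epsilon>"
    unfolding s4[symmetric] a' by (simp add: power_mult_distrib power_mult[symmetric] power_add[symmetric])
  then have "ln \<epsilon> \<le> - (a\<^sup>2)" by simp
  then have "exp (ln \<epsilon>) \<le> exp (- (a\<^sup>2))" by (simp only: exp_le_cancel_iff)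
  then show ?thesis using \<epsilon> by simp
qed

text \<open>The summand \<open>256\<close> is twice the constant of the Fejer inequality; the bracket bounds
  \<open>k\<^sup>2 \<integral>\<^bsub>[-k, k]\<^esub> \<bar>F\<bar>\<^sup>2 / M\<close> in the extrapolation case, where \<open>1057\<close> exceeds the maximum \<open>65\<^sup>2/4\<close> of \<open>65 k\<^sup>2 - k\<^sup>4\<close>.\<close>

definition stability_const :: real where
  "stability_const = 4 * (288 * exp 1057 + 48) + 256"

text \<open>The analysis reduced to real numbers: N and B are the energies of f and f', L is the L^1
  norm of f, and G adds the energies of F at \<alpha> and -\<alpha>. Each case compares its Fejer
  remainder with 2/(1 + a).\<close>

lemma stability_combination:
  fixes K N B M \<epsilon> L :: real and G :: "real \<Rightarrow> real"
  assumes K: "K > 1" and \<epsilon>: "0 < \<epsilon>" "\<epsilon> < 1" and M: "M \<ge> 1" "N + B \<le> M" and N: "N \<ge> 0" "B \<ge> 0"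
    and G: "continuous_on UNIV G" "\<And>\<alpha>. G \<alpha> \<ge> 0" and small: "integral {0..K} G \<le> 4 * \<epsilon>\<^sup>2"
    and fejer: "\<And>k. k > 0 \<Longrightarrow> N \<le> 2 * integral {0..k} G + 128 * (N + B) / k\<^sup>2"
    and L: "L\<^sup>2 \<le> 2 * N"
    and cont: "\<And>m \<alpha>. m \<ge> 1 \<Longrightarrow> 0 \<le> \<alpha> \<Longrightarrow> \<alpha> \<le> real m \<Longrightarrow>
      G \<alpha> \<le> 2 * (2 * (8 + 2 * L\<^sup>2) * \<epsilon> * 9 ^ (4 * m\<^sup>2) + 2 * L\<^sup>2 * exp (- 2 * real m))"
  shows "N \<le> stability_const * (\<epsilon>\<^sup>2 + M\<^sup>2 / (1 + K powr (2/3) * (- ln \<epsilon>) powr (1/4)))"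
proof -
  define a where "a = K powr (2/3) * (- ln \<epsilon>) powr (1/4)"
  have a0: "a \<ge> 0" by (simp add: a_def)
  have M2: "M \<le> M\<^sup>2" using M by (simp add: power2_eq_square)
  have sc: "stability_const \<ge> 256" "stability_const \<ge> 8" by (simp_all add: stability_const_def)
  have fejer': "N \<le> 2 * integral {0..k} G + 128 * M / k\<^sup>2" if "k > 0" for k
    using fejer[OF that] M(2) divide_right_mono[of "128 * (N + B)" "128 * M" "k\<^sup>2"] by auto
  \<comment> \<open>Both cases give the bound with M itself; M \<ge> 1 then allows M^2.\<close>
  have main: "N \<le> stability_const * (\<epsilon>\<^sup>2 + M / (1 + a))"
  proof (cases "a \<le> K\<^sup>2")
    case True
    have "1 \<le> K\<^sup>2" using K by (simp add: one_le_power)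
    then have "1 + a \<le> 2 * K\<^sup>2"
      using True by linarith
    then have "2 / (2 * K\<^sup>2) \<le> 2 / (1 + a)"
      using a0 K by (intro divide_left_mono) auto
    then have "1 / K\<^sup>2 \<le> 2 / (1 + a)"
      by simp
    then have "128 * M * (1 / K\<^sup>2) \<le> 128 * M * (2 / (1 + a))"
      using M by (intro mult_left_mono) auto
    then have "N \<le> 8 * \<epsilon>\<^sup>2 + 256 * (M / (1 + a))"
      using fejer'[of K] K small by simp
    also have "\<dots> \<le> stability_const * \<epsilon>\<^sup>2 + stability_const * (M / (1 + a))"
      using sc a0 M by (intro add_mono mult_right_mono) auto
    finally show ?thesis by (simp add: distrib_left)
  next
    case False
    define k where "k = sqrt a"
    have k2: "k\<^sup>2 = a" using a0 by (simp add: k_def)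
    have "1 < K\<^sup>2" using K by (simp add: one_less_power)
    then have a1: "1 < a" using False by simp
    then have k: "k > 1" by (simp add: k_def)
    \<comment> \<open>Rounding up makes [0, k] lie within reach of the extrapolation; m \<le> 2 k
      holds because k > 1.\<close>
    define m where "m = nat \<lceil>k\<rceil>"
    have m: "m \<ge> 1" "k \<le> real m" "real m \<le> 2 * k"
      using k unfolding m_def by linarith+
    have "\<epsilon> \<le> exp (- (a\<^sup>2))"
      using False by (intro neg_ln_large[OF K \<epsilon> a_def]) simp
    then have e4: "\<epsilon> \<le> exp (- (k ^ 4))"
      by (simp add: k2[symmetric] power_mult[symmetric])
    define b where "b = 2 * (2 * (8 + 2 * L\<^sup>2) * \<epsilon> * 9 ^ (4 * m\<^sup>2) + 2 * L\<^sup>2 * exp (- 2 * real m))"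
    have LM: "L\<^sup>2 \<le> 2 * M" "8 + 2 * L\<^sup>2 \<le> 12 * M"
      using L M N by auto
    have "integral {0..k} G \<le> integral {0..k} (\<lambda>_. b)"
    proof (rule integral_le)
      show "G integrable_on {0..k}"
        using G(1) by (intro integrable_continuous_real) (auto intro: continuous_on_subset)
      fix \<alpha> assume "\<alpha> \<in> {0..k}"
      then show "G \<alpha> \<le> b"
        unfolding b_def using m by (intro cont) auto
    qed auto
    then have "integral {0..k} G \<le> k * b" using k by simp
    \<comment> \<open>The decay 1/k^2 is wanted, so k^2 times the integral must be bounded. The
      length of [0, k] contributes the third power of k.\<close>
    then have "k\<^sup>2 * integral {0..k} G \<le> k\<^sup>2 * (k * b)"
      by (intro mult_left_mono) auto
    also have "k\<^sup>2 * (k * b) = k ^ 3 * b" by (simp add: eval_nat_numeral)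
    also have "k ^ 3 * b = 4 * (8 + 2 * L\<^sup>2) * (k ^ 3 * (\<epsilon> * 9 ^ (4 * m\<^sup>2))) + 4 * L\<^sup>2 * (k ^ 3 * exp (- 2 * real m))"
      by (simp add: b_def algebra_simps)
    \<comment> \<open>The products 4 * 12 * 6 = 288 and 4 * 2 * 6 = 48 are the numbers in
      \<open>stability_const\<close>.\<close>
    also have "\<dots> \<le> 4 * (12 * M) * (6 * exp 1057) + 4 * (2 * M) * 6"
    proof (rule add_mono)
      have "k ^ 3 * (\<epsilon> * 9 ^ (4 * m\<^sup>2)) \<le> 6 * exp 1057"
        using k m \<epsilon> e4 by (intro continuation_decay) auto
      then show "4 * (8 + 2 * L\<^sup>2) * (k ^ 3 * (\<epsilon> * 9 ^ (4 * m\<^sup>2))) \<le> 4 * (12 * M) * (6 * exp 1057)"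
        by (rule mult_mono[rotated]) (use LM k \<epsilon> M in auto)
      have "exp (- 2 * real m) \<le> exp (- k)"
        using k m by simp
      then have "k ^ 3 * exp (- 2 * real m) \<le> (6 * exp k) * exp (- k)"
        using k cube_le_exp[of k] by (intro mult_mono) auto
      also have "\<dots> = 6" by (simp add: mult.assoc exp_add[symmetric])
      finally show "4 * L\<^sup>2 * (k ^ 3 * exp (- 2 * real m)) \<le> 4 * (2 * M) * 6"
        by (rule mult_mono[rotated]) (use LM k M in auto)
    qed
    also have "\<dots> = (288 * exp 1057 + 48) * M" by (simp add: algebra_simps)
    finally have I: "integral {0..k} G \<le> (288 * exp 1057 + 48) * M / k\<^sup>2"
      using k by (simp add: pos_le_divide_eq mult.commute)
    have "N \<le> 2 * ((288 * exp 1057 + 48) * M / k\<^sup>2) + 128 * M / k\<^sup>2"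
      using fejer'[of k] k I by linarith
    also have "\<dots> = (2 * (288 * exp 1057 + 48) + 128) * M * (1 / a)"
      by (simp add: k2 add_divide_distrib algebra_simps)
    also have "\<dots> \<le> (2 * (288 * exp 1057 + 48) + 128) * M * (2 / (1 + a))"
      using a1 M by (intro mult_left_mono) (auto simp: field_simps)
    also have "\<dots> = stability_const * (M / (1 + a))"
      by (simp add: stability_const_def algebra_simps)
    also have "\<dots> \<le> stability_const * (\<epsilon>\<^sup>2 + M / (1 + a))"
      using sc by (intro mult_left_mono) auto
    finally show ?thesis .
  qed
  also have "\<dots> \<le> stability_const * (\<epsilon>\<^sup>2 + M\<^sup>2 / (1 + a))"
    using sc M2 a0 by (intro mult_left_mono add_left_mono divide_right_mono) auto
  finally show ?thesis
    by (simp add: a_def)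
qed

lemma stability_rhs_tendsto_0:
  fixes C D K :: real
  assumes K: "K > 0"
  shows "((\<lambda>\<epsilon>. C * (\<epsilon>\<^sup>2 + D / (1 + K powr (2/3) * (- ln \<epsilon>) powr (1/4)))) \<longlongrightarrow> 0) (at_right 0)"
proof -
  have 1: "filterlim (\<lambda>\<epsilon>::real. - ln \<epsilon>) at_top (at_right 0)"
    using ln_at_0 by (simp add: filterlim_uminus_at_top)
  have 2: "filterlim (\<lambda>y::real. y powr (1/4)) at_top at_top"
  proof -
    have "filterlim (\<lambda>y::real. exp (1 / 4 * ln y)) at_top at_top"
      by (intro filterlim_compose[OF exp_at_top] filterlim_tendsto_pos_mult_at_top[OF tendsto_const _ ln_at_top]) simp
    moreover have "eventually (\<lambda>y::real. exp (1 / 4 * ln y) = y powr (1 / 4)) at_top"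
      using eventually_gt_at_top[of 0] by eventually_elim (simp add: powr_def)
    ultimately show ?thesis
      by (rule filterlim_mono_eventually[OF _ order_refl order_refl])
  qed
  have "filterlim (\<lambda>\<epsilon>. K powr (2/3) * (- ln \<epsilon>) powr (1/4)) at_top (at_right 0)"
    using K by (intro filterlim_tendsto_pos_mult_at_top[OF tendsto_const _ filterlim_compose[OF 2 1]]) simp
  then have "filterlim (\<lambda>\<epsilon>. 1 + K powr (2/3) * (- ln \<epsilon>) powr (1/4)) at_top (at_right 0)"
    by (intro filterlim_tendsto_add_at_top[OF tendsto_const])
  then have "((\<lambda>\<epsilon>. D / (1 + K powr (2/3) * (- ln \<epsilon>) powr (1/4))) \<longlongrightarrow> 0) (at_right 0)"
    by (rule real_tendsto_divide_at_top[OF tendsto_const])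
  moreover have "((\<lambda>\<epsilon>::real. \<epsilon>\<^sup>2) \<longlongrightarrow> 0\<^sup>2) (at_right 0)"
    by (intro tendsto_intros)
  ultimately have "((\<lambda>\<epsilon>. C * (\<epsilon>\<^sup>2 + D / (1 + K powr (2/3) * (- ln \<epsilon>) powr (1/4)))) \<longlongrightarrow> C * (0\<^sup>2 + 0)) (at_right 0)"
    by (intro tendsto_intros)
  then show ?thesis by simp
qed

text \<open>Here \<epsilon> is any upper bound of the boundary data in (0, 1); this freedom allows
  the passage to the limit when the data vanish.\<close>

lemma stability_estimate:
  assumes f: "f \<in> sobolev_space 2 \<Omega>" and supp: "compactly_supported_in f \<Omega>"
    and u: "\<And>\<alpha>. \<alpha> > 0 \<Longrightarrow> helmholtz_solution \<alpha> f (u \<alpha>)" and K: "K > 1"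
    and \<epsilon>: "boundary_data u K \<le> \<epsilon>" "0 < \<epsilon>" "\<epsilon> < 1"
  shows "(sobolev_norm 0 \<Omega> f)\<^sup>2 \<le> stability_const *
    (\<epsilon>\<^sup>2 + (max ((sobolev_norm 1 \<Omega> f)\<^sup>2) 1)\<^sup>2 / (1 + K powr (2/3) * (- ln \<epsilon>) powr (1/4)))"
proof -
  obtain w w' where w: "AE x in \<Lambda>. f x = w x" "AE x in \<Lambda>. weak_deriv \<Omega> 1 f x = w' x"
    "\<And>x. (w has_vector_derivative w' x) (at x)" "continuous_on UNIV w'"
    "\<And>x. 1 \<le> \<bar>x\<bar> \<Longrightarrow> w x = 0" "\<And>x. 1 \<le> \<bar>x\<bar> \<Longrightarrow> w' x = 0"
    by (rule compact_support_representative[OF f supp]) blast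
  have wc: "continuous_on {-1..1} w"
    using has_vector_derivative_at_within[OF w(3)] by (rule has_vector_derivative_continuous_on)
  have w'c: "continuous_on {-1..1} w'"
    using w(4) continuous_on_subset by blast
  interpret interval_fourier w by standard (rule wc)
  define N where "N = integral {-1..1} (\<lambda>x. (cmod (w x))\<^sup>2)"
  define B where "B = integral {-1..1} (\<lambda>x. (cmod (w' x))\<^sup>2)"
  define G where "G \<alpha> = (cmod (transform \<alpha>))\<^sup>2 + (cmod (transform (- \<alpha>)))\<^sup>2" for \<alpha>
  have nn: "N \<ge> 0" "B \<ge> 0"
    unfolding N_def B_def
    by (rule Henstock_Kurzweil_Integration.integral_nonneg;
      auto intro!: integrable_continuous_real continuous_intros wc w'c)+
  note norms = sobolev_norm_0_1[OF f wc w(1) w'c w(2), folded N_def B_def]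
  have Gc: "continuous_on UNIV G"
    unfolding G_def[abs_def] by (rule boundary_data_eq(3)[OF u wc w(1) order_refl])
  have "integral {0..K} G = 4 * (boundary_data u K)\<^sup>2" "0 \<le> boundary_data u K"
    using boundary_data_eq(1,2)[OF u wc w(1)] K unfolding G_def[abs_def] by simp_all
  then have small: "integral {0..K} G \<le> 4 * \<epsilon>\<^sup>2"
    using \<epsilon> by (simp add: power_mono)
  \<comment> \<open>The condition K > 1 ensures that the measured band contains [0, 1], from which
    the extrapolation starts.\<close>
  have "integral {0..1} G \<le> integral {0..K} G"
    using K Gc by (intro integral_subset_le integrable_continuous_real)
      (auto simp: G_def intro: continuous_on_subset)
  then have int1: "integral {0..1} (\<lambda>\<beta>. (cmod (transform \<beta>))\<^sup>2 + (cmod (transform (- \<beta>)))\<^sup>2) \<le> 4 * \<epsilon>\<^sup>2"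
    using small by (simp add: G_def[abs_def])
  have cont: "G \<alpha> \<le> 2 * (2 * (8 + 2 * L1\<^sup>2) * \<epsilon> * 9 ^ (4 * m\<^sup>2) + 2 * L1\<^sup>2 * exp (- 2 * real m))"
    if "m \<ge> 1" "0 \<le> \<alpha>" "\<alpha> \<le> real m" for m \<alpha>
    using transform_continuation[OF that(1) \<epsilon>(2) less_imp_le[OF \<epsilon>(3)] int1, of \<alpha>]
      transform_continuation[OF that(1) \<epsilon>(2) less_imp_le[OF \<epsilon>(3)] int1, of "- \<alpha>"] that
    by (simp add: G_def)
  have "N \<le> stability_const *
    (\<epsilon>\<^sup>2 + (max ((sobolev_norm 1 \<Omega> f)\<^sup>2) 1)\<^sup>2 / (1 + K powr (2/3) * (- ln \<epsilon>) powr (1/4)))"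
  proof (rule stability_combination[OF K \<epsilon>(2,3) _ _ nn Gc _ small _ _ cont])
    show "N \<le> 2 * integral {0..k} G + 128 * (N + B) / k\<^sup>2" if "k > 0" for k
      unfolding N_def B_def G_def[abs_def]
      by (rule complex_fejer_inequality[OF w(3-6) that])
    show "L1\<^sup>2 \<le> 2 * N"
      unfolding N_def by (rule L1_square_le[OF wc])
  qed (auto simp: norms G_def simp del: One_nat_def)
  then show ?thesis
    by (simp only: norms)
qed

theorem theorem1p1:
  shows "\<exists>C::real. C > 0 \<and>
    (\<forall>(f :: real \<Rightarrow> complex) (u :: real \<Rightarrow> real \<Rightarrow> complex) (K :: real) (\<epsilon> :: real) (E :: ereal) (M :: real).
       f \<in> sobolev_space 2 \<Omega> \<longrightarrow>
       compactly_supported_in f \<Omega> \<longrightarrow>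
       (\<forall>\<alpha>>0. helmholtz_solution \<alpha> f (u \<alpha>)) \<longrightarrow>
       K > 1 \<longrightarrow>
       \<epsilon> = boundary_data u K \<longrightarrow>
       E = neg_ln \<epsilon> \<longrightarrow>
       M = max ((sobolev_norm 1 \<Omega> f)\<^sup>2) 1 \<longrightarrow>
       ereal ((sobolev_norm 0 \<Omega> f)\<^sup>2) \<le>
         ereal C * (ereal (\<epsilon>\<^sup>2) +
           ereal (M\<^sup>2) / (1 + ereal (K powr (2/3)) * fourth_root E)))"
proof (intro exI[of _ stability_const] conjI allI impI)
  show C: "stability_const > 0"
    by (simp add: stability_const_def add_pos_pos)
  fix f u K \<epsilon> E M
  assume f: "f \<in> sobolev_space 2 \<Omega>" and supp: "compactly_supported_in f \<Omega>"
    and u: "\<forall>\<alpha>>0. helmholtz_solution \<alpha> f (u \<alpha>)" and K: "K > 1"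
    and \<epsilon>: "\<epsilon> = boundary_data u K" and E: "E = neg_ln \<epsilon>"
    and M: "M = max ((sobolev_norm 1 \<Omega> f)\<^sup>2) 1"
  define N where "N = (sobolev_norm 0 \<Omega> f)\<^sup>2"
  note est = stability_estimate[OF f supp _ K, folded M, folded N_def, OF u[rule_format]]
  obtain w w' where w: "AE x in \<Lambda>. f x = w x" "AE x in \<Lambda>. weak_deriv \<Omega> 1 f x = w' x"
    "\<And>x. (w has_vector_derivative w' x) (at x)" "continuous_on UNIV w'"
    by (rule compact_support_representative[OF f supp]) blast
  have wc: "continuous_on {-1..1} w"
    using has_vector_derivative_at_within[OF w(3)] by (rule has_vector_derivative_continuous_on)
  have w'c: "continuous_on {-1..1} w'"
    using w(4) continuous_on_subset by blast
  have "0 \<le> integral {-1..1} (\<lambda>x. (cmod (w' x))\<^sup>2)"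
    by (rule Henstock_Kurzweil_Integration.integral_nonneg)
      (auto intro!: integrable_continuous_real continuous_intros w'c)
  then have NM: "N \<le> M"
    using sobolev_norm_0_1[OF f wc w(1) w'c w(2)] by (simp add: N_def M)
  have \<epsilon>0: "\<epsilon> \<ge> 0"
    using boundary_data_eq(2)[OF u[rule_format] wc w(1)] K by (simp add: \<epsilon>)
  have C1: "stability_const \<ge> 1"
    by (simp add: stability_const_def)
  show "ereal ((sobolev_norm 0 \<Omega> f)\<^sup>2) \<le>
         ereal stability_const * (ereal (\<epsilon>\<^sup>2) + ereal (M\<^sup>2) / (1 + ereal (K powr (2/3)) * fourth_root E))"
  proof (cases "\<epsilon> < 1")
    case True
    show ?thesis
    proof (cases "\<epsilon> = 0")
      case True
      \<comment> \<open>The estimate holds with every positive upper bound of the boundary data in place of \<open>\<epsilon>\<close>, and its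
        right-hand side vanishes in the limit.\<close>
      have "eventually (\<lambda>e. N \<le> stability_const * (e\<^sup>2 + M\<^sup>2 / (1 + K powr (2/3) * (- ln e) powr (1/4)))) (at_right 0)"
        unfolding eventually_at_right_field
        using est \<epsilon> True by (intro exI[of _ 1]) auto
      then have "N \<le> 0"
        using K by (intro tendsto_lowerbound[OF stability_rhs_tendsto_0]) auto
      \<comment> \<open>The denominator is infinite, so the extended quotient is 0 and the claim
        becomes N \<le> 0.\<close>
      moreover have "fourth_root E = \<infinity>"
        using True by (simp add: E neg_ln_def fourth_root_def)
      ultimately show ?thesis
        using K True by (simp add: N_def)
    next
      case False
      have "fourth_root E = ereal ((- ln \<epsilon>) powr (1/4))"
        using \<open>\<epsilon> < 1\<close> False \<epsilon>0 by (simp add: E neg_ln_def fourth_root_def)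
      moreover have "1 + K powr (2/3) * (- ln \<epsilon>) powr (1/4) \<noteq> 0"
        by (smt (verit) mult_nonneg_nonneg powr_ge_zero)
      ultimately show ?thesis
        using est[of \<epsilon>] \<epsilon> False \<epsilon>0 \<open>\<epsilon> < 1\<close> by (simp add: N_def one_ereal_def)
    qed
  next
    case False
    \<comment> \<open>For \<epsilon> \<ge> 1, E \<le> 0 and the truncated root is 0. The denominator
      is then 1, and the claim follows from N \<le> M \<le> M^2.\<close>
    then have "fourth_root E = 0"
      by (simp add: E neg_ln_def fourth_root_def zero_ereal_def)
    moreover have "N \<le> stability_const * (\<epsilon>\<^sup>2 + M\<^sup>2)"
    proof -
      have "M \<le> M\<^sup>2"
        by (rule self_le_power) (auto simp: M)
      then have "N \<le> \<epsilon>\<^sup>2 + M\<^sup>2"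
        using NM zero_le_power2[of \<epsilon>] by linarith
      also have "\<dots> \<le> stability_const * (\<epsilon>\<^sup>2 + M\<^sup>2)"
        using mult_right_mono[OF C1, of "\<epsilon>\<^sup>2 + M\<^sup>2"] by simp
      finally show ?thesis .
    qed
    ultimately show ?thesis
      by (simp add: N_def)
  qed
qed

end
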